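(* Let $q$ be a prime power, $\nu\ge1$, and let $m,s$ be non-negative integers with $2s\le m\le \nu+s$ and $1\le m\le 2\nu-1$. Then $\mathcal{M}(m,s;2\nu)$ is exactly one orbit of the vertex set of $Spi(2\nu,q)$ under the action of $\mathrm{Aut}(Spi(2\nu,q))$.
   Context: $\mathbb{F}_q^{(2\nu)}$ is the space of row vectors of length $2\nu$ over $\mathbb{F}_q$ and $K_{2\nu}=\begin{pmatrix}0 & I^{(\nu)}\\ -I^{(\nu)} & 0\end{pmatrix}$. A subspace $P$ of dimension $m$ is identified with any $m\times2\nu$ matrix whose rows form a basis of $P$; $P$ is of type $(m,s)$ if $PK_{2\nu}{}^tP$ has rank $2s$, and $\mathcal{M}(m,s;2\nu)$ is the set of subspaces of type $(m,s)$. The graph $Spi(2\nu,q)$ has as vertex set all subspaces of $\mathbb{F}_q^{(2\nu)}$ other than $0$ and $\mathbb{F}_q^{(2\nu)}$, with $A,B$ (not necessarily distinct) adjacent iff $AK_{2\nu}{}^tB=0$; $\mathrm{Aut}(Spi(2\nu,q))$ is its automorphism group, acting on vertices. *)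

theory Defs
  imports
    "HOL-Library.Cardinality"
    "HOL-Algebra.Group_Action"
    "Jordan_Normal_Form.DL_Rank"
begin

definition symp_mat :: "nat \<Rightarrow> 'a::field mat" where
  "symp_mat \<nu> = four_block_mat (0\<^sub>m \<nu> \<nu>) (1\<^sub>m \<nu>) (- 1\<^sub>m \<nu>) (0\<^sub>m \<nu> \<nu>)"

text \<open>Vectors of the library serve as row vectors. Since the rows are distinct, the number of rows of
  \<open>P\<close> is the dimension of \<open>W\<close>.\<close>

definition represents :: "nat \<Rightarrow> 'a::field mat \<Rightarrow> 'a vec set \<Rightarrow> bool" where
  "represents n P W \<longleftrightarrow>
     dim_col P = n \<and> distinct (rows P) \<and>
     \<not> module.lin_dep class_ring (module_vec TYPE('a) n) (set (rows P)) \<and>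
     LinearCombinations.module.span class_ring (module_vec TYPE('a) n) (set (rows P)) = W"

text \<open>The existential choice of a representing matrix below is immaterial: every subspace has one, and
  any two differ by an invertible left factor, which affects neither the rank of
  \<open>P * symp_mat \<nu> * P\<^sup>T\<close> nor the vanishing of \<open>P * symp_mat \<nu> * Q\<^sup>T\<close>.\<close>

definition subspaces_of_type :: "nat \<Rightarrow> nat \<Rightarrow> nat \<Rightarrow> 'a::field vec set set" where
  "subspaces_of_type m s \<nu> =
     {W. subspace class_ring W (module_vec TYPE('a) (2 * \<nu>)) \<and>
         (\<exists>P. P \<in> carrier_mat m (2 * \<nu>) \<and> represents (2 * \<nu>) P W \<and>
              vec_space.rank m (P * symp_mat \<nu> * P\<^sup>T) = 2 * s)}"

definition spi_verts :: "nat \<Rightarrow> 'a::field vec set set" where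
  "spi_verts \<nu> =
     {W. subspace class_ring W (module_vec TYPE('a) (2 * \<nu>)) \<and>
         W \<noteq> {0\<^sub>v (2 * \<nu>)} \<and> W \<noteq> carrier_vec (2 * \<nu>)}"

definition spi_adj :: "nat \<Rightarrow> 'a::field vec set \<Rightarrow> 'a vec set \<Rightarrow> bool" where
  "spi_adj \<nu> A B \<longleftrightarrow>
     (\<exists>P Q. represents (2 * \<nu>) P A \<and> represents (2 * \<nu>) Q B \<and>
            P * symp_mat \<nu> * Q\<^sup>T = 0\<^sub>m (dim_row P) (dim_row Q))"

definition graph_Aut :: "'v set \<Rightarrow> ('v \<Rightarrow> 'v \<Rightarrow> bool) \<Rightarrow> ('v \<Rightarrow> 'v) monoid" where
  "graph_Aut V adj =
     BijGroup V \<lparr>carrier := {f \<in> Bij V. \<forall>x\<in>V. \<forall>y\<in>V. adj (f x) (f y) \<longleftrightarrow> adj x y}\<rparr>"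

lemma group_action_graph_Aut: "group_action (graph_Aut V adj) V (\<lambda>f. f)"
proof -
  interpret B: group "BijGroup V" by (rule group_BijGroup)
  let ?H = "{f \<in> Bij V. \<forall>x\<in>V. \<forall>y\<in>V. adj (f x) (f y) \<longleftrightarrow> adj x y}"
  have maps: "f x \<in> V" if "f \<in> Bij V" "x \<in> V" for f x
    using that Bij_imp_funcset by blast
  have "subgroup ?H (BijGroup V)"
  proof (rule B.subgroupI)
    show "?H \<subseteq> carrier (BijGroup V)" by (auto simp: BijGroup_def)
    show "?H \<noteq> {}" using id_Bij[of V] by (auto intro!: exI[of _ "\<lambda>x\<in>V. x"])
  next
    fix f assume f: "f \<in> ?H"
    let ?g = "\<lambda>x\<in>V. inv_into V f x"
    have g: "?g \<in> Bij V" using f restrict_inv_into_Bij by blast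
    have fg: "f (?g x) = x" if "x \<in> V" for x
      using that f by (auto simp: Bij_def bij_betw_def f_inv_into_f)
    have "adj (?g x) (?g y) \<longleftrightarrow> adj x y" if "x \<in> V" "y \<in> V" for x y
    proof -
      have "adj (f (?g x)) (f (?g y)) \<longleftrightarrow> adj (?g x) (?g y)"
        using f maps[OF g that(1)] maps[OF g that(2)] by blast
      then show ?thesis unfolding fg[OF that(1)] fg[OF that(2)] by blast
    qed
    then show "inv\<^bsub>BijGroup V\<^esub> f \<in> ?H" using f g by (simp add: inv_BijGroup)
  next
    fix f g assume "f \<in> ?H" "g \<in> ?H"
    then show "f \<otimes>\<^bsub>BijGroup V\<^esub> g \<in> ?H"
      by (auto simp: BijGroup_def compose_Bij maps compose_eq)
  qed
  then interpret S: subgroup ?H "BijGroup V" .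
  have "group_hom (graph_Aut V adj) (BijGroup V) (\<lambda>f. f)"
    unfolding graph_Aut_def
    using S.subgroup_is_group[OF B.is_group] B.is_group
    by (auto simp: group_hom_def group_hom_axioms_def hom_def BijGroup_def)
  then show ?thesis by (simp add: group_action_def)
qed

definition spi_Aut :: "nat \<Rightarrow> ('a::field vec set \<Rightarrow> 'a vec set) monoid" where
  "spi_Aut \<nu> = graph_Aut (spi_verts \<nu>) (spi_adj \<nu>)"

end

theory Submission
  imports Defs
begin

text \<open>
  Over a finite field the dimension of a subspace is read off its cardinality, so a subspace \<open>W\<close> has
  type \<open>(m, s)\<close> iff \<open>W\<close> has \<open>q\<^sup>m\<close> elements and its radical \<open>W \<inter> W\<^sup>\<bottom>\<close> has \<open>q\<close> to the power \<open>m - 2s\<close> elements.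

  Automorphisms preserve the type: adjacency of \<open>A\<close> and \<open>B\<close> means \<open>B \<subseteq> A\<^sup>\<bottom>\<close>, so by \<open>A\<^sup>\<bottom>\<^sup>\<bottom> = A\<close> inclusion is
  inclusion of neighbourhoods and is preserved; hence so are dimensions (chains of subspaces), and the
  radical is the largest subspace of \<open>A\<close> adjacent to \<open>A\<close>.

  Conversely, isometries induce automorphisms, and two subspaces of equal type are related by an
  isometry (Witt): split off, on both sides simultaneously, a hyperbolic plane whose intersection with
  the subspace is the whole plane, a line or zero, and continue in its orthogonal complement.
\<close>

subsection \<open>Subspaces over a finite field\<close>

abbreviation lin_subspace :: "nat \<Rightarrow> 'a::field vec set \<Rightarrow> bool" where
  "lin_subspace n W \<equiv> subspace class_ring W (module_vec TYPE('a) n)"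

lemma lin_subspace_iff:
  fixes W :: "'a::field vec set"
  shows "lin_subspace n W \<longleftrightarrow>
     W \<subseteq> carrier_vec n \<and> 0\<^sub>v n \<in> W \<and> (\<forall>x\<in>W. \<forall>y\<in>W. x + y \<in> W) \<and> (\<forall>c. \<forall>x\<in>W. c \<cdot>\<^sub>v x \<in> W)"
  using vec_vs[of n, where 'a='a] vec_module[of n, where 'a='a]
  by (auto simp: subspace_def submodule_def module_vec_simps class_ring_simps)

lemma finite_carrier_vec: "finite (carrier_vec n :: 'a::finite vec set)"
  and card_carrier_vec: "card (carrier_vec n :: 'a::finite vec set) = CARD('a) ^ n"
proof -
  have b: "bij_betw (\<lambda>f. vec n f) ({..<n} \<rightarrow>\<^sub>E UNIV) (carrier_vec n :: 'a vec set)"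
    by (rule bij_betwI[where g = "\<lambda>v. restrict (vec_index v) {..<n}"])
      (auto simp: PiE_def extensional_def fun_eq_iff restrict_def)
  show "finite (carrier_vec n :: 'a vec set)"
    using bij_betw_finite[OF b] by (simp add: finite_PiE)
  show "card (carrier_vec n :: 'a vec set) = CARD('a) ^ n"
    using bij_betw_same_card[OF b] by (simp add: card_PiE)
qed

lemma card_field_gt_1: "1 < CARD('a::{field,finite})"
  using card_mono[of UNIV "{0 :: 'a, 1}"] by simp

text \<open>Combinations of the rows of \<open>P\<close> are the vectors
  \<open>P\<^sup>T *\<^sub>v c\<close>, so spanning turns into surjectivity onto \<open>W\<close>
  and independence into injectivity. A basis matrix thus acts as a coordinate bijection.\<close>

lemma represents_imp_range:
  fixes P :: "'a::field mat"
  assumes "represents n P W"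
  shows "W = (\<lambda>c. P\<^sup>T *\<^sub>v c) ` carrier_vec (dim_row P)"
    and "inj_on (\<lambda>c. P\<^sup>T *\<^sub>v c) (carrier_vec (dim_row P))"
proof -
  interpret vec_space "TYPE('a)" n .
  define m where "m = dim_row P"
  have P: "P \<in> carrier_mat m n" and d: "distinct (rows P)" and li: "lin_indpt (set (rows P))"
    and sp: "span (set (rows P)) = W"
    using assms by (auto simp: represents_def m_def)
  have PT: "P\<^sup>T \<in> carrier_mat n m" using P by auto
  have len: "length (rows P) = m" using P by simp
  show "W = (\<lambda>c. P\<^sup>T *\<^sub>v c) ` carrier_vec (dim_row P)"
    unfolding m_def[symmetric]
    using sp row_space_eq[OF P] PT P by (auto simp: row_space_def)
  have rc: "set (rows P) \<subseteq> carrier_vec n" using P by (auto simp: rows_def)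
  have z: "x = 0\<^sub>v m" if x: "x \<in> carrier_vec m" and x0: "P\<^sup>T *\<^sub>v x = 0\<^sub>v n" for x
  proof -
    \<comment> \<open>\<open>lincomb\<close> attaches coefficients to vectors, while
      \<open>x\<close> is indexed by positions; since the rows are distinct, each row determines its
      position.\<close>
    define a where "a v = x $ (THE i. i < m \<and> rows P ! i = v)" for v
    have a: "a (rows P ! i) = x $ i" if "i < m" for i
    proof -
      have "(THE j. j < m \<and> rows P ! j = rows P ! i) = i"
        using that d len by (intro the_equality) (auto simp del: nth_rows simp: nth_eq_iff_index_eq)
      then show ?thesis by (simp add: a_def)
    qed
    have "lincomb a (set (rows P)) = lincomb_list (\<lambda>i. a (rows P ! i)) (rows P)"
      by (rule lincomb_as_lincomb_list_distinct[OF rc d])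
    also have "\<dots> = mat_of_cols n (rows P) *\<^sub>v vec (length (rows P)) (\<lambda>i. a (rows P ! i))"
      by (rule lincomb_list_as_mat_mult) (use rc in auto)
    also have "mat_of_cols n (rows P) = P\<^sup>T"
      using mat_of_cols_cols[of "P\<^sup>T"] PT P by auto
    also have "vec (length (rows P)) (\<lambda>i. a (rows P ! i)) = x"
      using x a len by (intro eq_vecI) auto
    finally have l0: "lincomb a (set (rows P)) = 0\<^sub>v n" using x0 by simp
    have "a v = 0" if "v \<in> set (rows P)" for v
      using li lin_dep_crit[of "set (rows P)" "set (rows P)" v a] l0 that by auto
    then have "x $ i = 0" if "i < m" for i
      using a[OF that] that len by (metis nth_mem)
    then show ?thesis using x by (intro eq_vecI) auto
  qed
  show "inj_on (\<lambda>c. P\<^sup>T *\<^sub>v c) (carrier_vec (dim_row P))"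
    unfolding m_def[symmetric]
  proof (rule inj_onI)
    fix x y assume xy: "x \<in> carrier_vec m" "y \<in> carrier_vec m" "P\<^sup>T *\<^sub>v x = P\<^sup>T *\<^sub>v y"
    have "P\<^sup>T *\<^sub>v (x - y) = 0\<^sub>v n"
      using xy PT by (simp add: mult_minus_distrib_mat_vec[OF PT])
    then have "x - y = 0\<^sub>v m" using z xy by auto
    then show "x = y" using xy
      by (intro eq_vecI) (auto, metis eq_iff_diff_eq_0 carrier_vecD index_minus_vec(1) index_zero_vec(1))
  qed
qed

lemma card_represents:
  fixes P :: "'a::{field,finite} mat"
  assumes "represents n P W"
  shows "card W = CARD('a) ^ dim_row P"
  using represents_imp_range[OF assms] by (simp add: card_image card_carrier_vec)

text \<open>A maximal independent subset of \<open>W\<close> serves as the rows; it exists because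
  independent sets in dimension \<open>n\<close> have at most \<open>n\<close> elements. The row
  count is tied to \<open>dim\<close> because the rank of a matrix is such a dimension.\<close>

lemma subspace_represented_dim:
  fixes W :: "'a::field vec set"
  assumes "lin_subspace n W"
  obtains P where "represents n P W"
    "dim_row P = vectorspace.dim class_ring ((module_vec TYPE('a) n)\<lparr>carrier := W\<rparr>)"
proof -
  interpret vec_space "TYPE('a)" n .
  interpret S: vectorspace class_ring "vs W" using subspace_is_vs[OF assms] .
  have sub: "submodule class_ring W V" using assms by simp
  have Wc: "W \<subseteq> carrier_vec n" using assms by (simp add: lin_subspace_iff)
  have li_eq: "S.lin_indpt A \<longleftrightarrow> lin_indpt A" if "A \<subseteq> W" for A
    using span_li_not_depend(2)[OF that sub] by simp
  have "\<exists>A. finite A \<and> maximal A (\<lambda>T. T \<subseteq> carrier (vs W) \<and> S.lin_indpt T)"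
  proof (rule maximal_exists[where B = "{}" and N = n])
    fix A assume "A \<subseteq> carrier (vs W) \<and> S.lin_indpt A"
    then show "finite A \<and> card A \<le> n"
      using li_le_dim[of A] li_eq[of A] Wc by (auto simp: dim_is_n)
  qed (auto simp: S.lin_dep_def)
  then obtain A where A: "finite A" "maximal A (\<lambda>T. T \<subseteq> carrier (vs W) \<and> S.lin_indpt T)" by blast
  have AW: "A \<subseteq> W" and "S.lin_indpt A" using A(2) by (auto simp: maximal_def)
  then have li: "lin_indpt A" using li_eq by blast
  have bas: "S.basis A" using S.max_li_is_basis[OF A(2)] .
  then have "span A = W"
    using span_li_not_depend(1)[OF AW sub] by (simp add: S.basis_def)
  moreover obtain xs where xs: "set xs = A" "distinct xs" using finite_distinct_list[OF A(1)] by blast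
  moreover have "rows (mat_of_rows n xs) = xs"
    by (rule rows_mat_of_rows) (use xs AW Wc in auto)
  ultimately have "represents n (mat_of_rows n xs) W" using li by (simp add: represents_def)
  moreover have "dim_row (mat_of_rows n xs) = S.dim"
    using S.dim_basis[OF A(1) bas] xs distinct_card by fastforce
  ultimately show ?thesis using that by blast
qed

text \<open>The image is the span of the columns, whose dimension is the rank; a basis matrix of
  that span counts it.\<close>

lemma card_range_rank:
  fixes A :: "'a::{field,finite} mat"
  assumes A: "A \<in> carrier_mat n k"
  shows "card ((\<lambda>x. A *\<^sub>v x) ` carrier_vec k) = CARD('a) ^ vec_space.rank n A"
proof -
  interpret vec_space "TYPE('a)" n .
  have sub: "subspace class_ring (span (set (cols A))) V"
    by (rule span_is_subspace) (use A cols_dim[of A] in auto)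
  obtain P where "represents n P (span (set (cols A)))" "dim_row P = rank A"
    using subspace_represented_dim[OF sub] by (auto simp: rank_def)
  moreover have "span (set (cols A)) = (\<lambda>x. A *\<^sub>v x) ` carrier_vec k"
    using col_space_eq[OF A] A by (auto simp: col_space_def)
  ultimately show ?thesis using card_represents by metis
qed

lemma lin_subspaceD:
  fixes W :: "'a::field vec set"
  assumes "lin_subspace n W"
  shows "W \<subseteq> carrier_vec n" "0\<^sub>v n \<in> W"
    "x \<in> W \<Longrightarrow> x \<in> carrier_vec n" "x \<in> W \<Longrightarrow> dim_vec x = n"
    "x \<in> W \<Longrightarrow> y \<in> W \<Longrightarrow> x + y \<in> W" "x \<in> W \<Longrightarrow> c \<cdot>\<^sub>v x \<in> W"
    "x \<in> W \<Longrightarrow> y \<in> W \<Longrightarrow> x - y \<in> W"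
proof -
  show c: "W \<subseteq> carrier_vec n" "0\<^sub>v n \<in> W" "x \<in> W \<Longrightarrow> x \<in> carrier_vec n" "x \<in> W \<Longrightarrow> dim_vec x = n"
    "x \<in> W \<Longrightarrow> y \<in> W \<Longrightarrow> x + y \<in> W" "x \<in> W \<Longrightarrow> c \<cdot>\<^sub>v x \<in> W" for x y c
    using assms by (auto simp: lin_subspace_iff)
  show "x - y \<in> W" if "x \<in> W" "y \<in> W"
  proof -
    have "x - y = x + (-1) \<cdot>\<^sub>v y" using c(4) that by (intro eq_vecI) auto
    then show ?thesis using c(5,6) that by metis
  qed
qed

lemma lin_subspaceI:
  assumes "W \<subseteq> carrier_vec n" "0\<^sub>v n \<in> W" "\<And>x y. x \<in> W \<Longrightarrow> y \<in> W \<Longrightarrow> x + y \<in> W"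
    "\<And>c x. x \<in> W \<Longrightarrow> c \<cdot>\<^sub>v x \<in> W"
  shows "lin_subspace n W"
  using assms by (simp add: lin_subspace_iff)

lemma lin_subspace_zero: "lin_subspace n {0\<^sub>v n}"
  by (rule lin_subspaceI) auto

lemma lin_subspace_carrier: "lin_subspace n (carrier_vec n)"
  by (rule lin_subspaceI) auto

lemma finite_lin_subspace:
  "lin_subspace n (W :: 'a::{field,finite} vec set) \<Longrightarrow> finite W"
  using finite_subset[OF lin_subspaceD(1) finite_carrier_vec] .

lemma card_lin_subspace_pos:
  "lin_subspace n (W :: 'a::{field,finite} vec set) \<Longrightarrow> 0 < card W"
  using finite_lin_subspace lin_subspaceD(2) by (fastforce simp: card_gt_0_iff)

lemma lin_subspace_card_eq_1:
  assumes "lin_subspace n (W :: 'a::{field,finite} vec set)"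
  shows "card W = 1 \<longleftrightarrow> W = {0\<^sub>v n}"
  using lin_subspaceD(2)[OF assms] by (auto simp: card_1_singleton_iff)

section \<open>Extension by one vector, and hyperplanes\<close>

definition line_ext :: "'a::field vec set \<Rightarrow> 'a vec \<Rightarrow> 'a vec set" where
  "line_ext B a = {y + c \<cdot>\<^sub>v a | y c. y \<in> B}"

lemma lin_subspace_line_ext:
  assumes B: "lin_subspace n B" and a: "a \<in> carrier_vec n"
  shows "lin_subspace n (line_ext B a)"
proof (rule lin_subspaceI)
  note D = lin_subspaceD[OF B]
  show "line_ext B a \<subseteq> carrier_vec n" using D(3) a by (auto simp: line_ext_def)
  have "0\<^sub>v n = 0\<^sub>v n + 0 \<cdot>\<^sub>v a" using a by (intro eq_vecI) auto
  then show "0\<^sub>v n \<in> line_ext B a" using D(2) unfolding line_ext_def by blast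
  fix x assume "x \<in> line_ext B a"
  then obtain u c where x: "x = u + c \<cdot>\<^sub>v a" "u \<in> B" by (auto simp: line_ext_def)
  show "d \<cdot>\<^sub>v x \<in> line_ext B a" for d
  proof -
    have "d \<cdot>\<^sub>v x = d \<cdot>\<^sub>v u + (d * c) \<cdot>\<^sub>v a"
      using x D(4) a by (intro eq_vecI) (auto simp: algebra_simps)
    then show ?thesis using D(6)[OF x(2)] unfolding line_ext_def by blast
  qed
  fix y assume "y \<in> line_ext B a"
  then obtain v d where y: "y = v + d \<cdot>\<^sub>v a" "v \<in> B" by (auto simp: line_ext_def)
  have "x + y = (u + v) + (c + d) \<cdot>\<^sub>v a"
    using x y D(4) a by (intro eq_vecI) (auto simp: algebra_simps)
  then show "x + y \<in> line_ext B a" using D(5)[OF x(2) y(2)] unfolding line_ext_def by blast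
qed

lemma line_ext_subset:
  assumes "lin_subspace n A" "B \<subseteq> A" "a \<in> A"
  shows "line_ext B a \<subseteq> A"
  using lin_subspaceD(5,6)[OF assms(1)] assms(2,3) by (auto simp: line_ext_def)

lemma subset_line_ext:
  assumes B: "lin_subspace n B" and a: "a \<in> carrier_vec n"
  shows "B \<subseteq> line_ext B a" "a \<in> line_ext B a"
proof -
  note D = lin_subspaceD[OF B]
  show "B \<subseteq> line_ext B a"
  proof
    fix x assume x: "x \<in> B"
    have "x = x + 0 \<cdot>\<^sub>v a" using x D(4) a by (intro eq_vecI) auto
    then show "x \<in> line_ext B a" using x unfolding line_ext_def by blast
  qed
  have "a = 0\<^sub>v n + 1 \<cdot>\<^sub>v a" using a by (intro eq_vecI) auto
  then show "a \<in> line_ext B a" using D(2) unfolding line_ext_def by blast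
qed

text \<open>Two representations with different coefficients could be solved for \<open>a\<close>,
  which would then lie in \<open>B\<close>.\<close>

lemma card_line_ext:
  fixes B :: "'a::{field,finite} vec set"
  assumes B: "lin_subspace n B" and a: "a \<in> carrier_vec n" "a \<notin> B"
  shows "card (line_ext B a) = CARD('a) * card B"
proof -
  note D = lin_subspaceD[OF B]
  have "inj_on (\<lambda>(y, c). y + c \<cdot>\<^sub>v a) (B \<times> UNIV)"
  proof (rule inj_onI, clarify)
    fix y c z d assume yz: "y \<in> B" "z \<in> B" and eq: "y + c \<cdot>\<^sub>v a = z + d \<cdot>\<^sub>v a"
    have p: "y $ i + c * a $ i = z $ i + d * a $ i" if "i < n" for i
      using arg_cong[OF eq, of "\<lambda>v. v $ i"] that a D(4) yz by simp
    have "c = d"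
    proof (rule ccontr)
      assume cd: "c \<noteq> d"
      have "a = inverse (c - d) \<cdot>\<^sub>v (z - y)"
      proof (rule eq_vecI)
        fix i assume "i < dim_vec (inverse (c - d) \<cdot>\<^sub>v (z - y))"
        then have i: "i < n" using D(4) yz by simp
        have "(c - d) * a $ i = z $ i - y $ i" using p[OF i] by (simp add: algebra_simps)
        then have "a $ i = inverse (c - d) * (z $ i - y $ i)" using cd by (simp add: field_simps)
        then show "a $ i = (inverse (c - d) \<cdot>\<^sub>v (z - y)) $ i" using i D(4) yz by simp
      qed (use a D(4) yz in auto)
      then show False using a D(6)[OF D(7)[OF yz(2,1)]] by metis
    qed
    then have "y = z" using p D(4) yz by (intro eq_vecI) auto
    then show "y = z \<and> c = d" using \<open>c = d\<close> by blast
  qed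
  moreover have "line_ext B a = (\<lambda>(y, c). y + c \<cdot>\<^sub>v a) ` (B \<times> UNIV)"
    by (auto simp: line_ext_def image_iff)
  ultimately show ?thesis by (simp add: card_image card_cartesian_product)
qed

text \<open>Adding a single vector of the difference already multiplies the size by the order of the
  field. This is the counting form of the strict growth of dimension.\<close>

lemma card_proper_subspace:
  fixes A B :: "'a::{field,finite} vec set"
  assumes A: "lin_subspace n A" and B: "lin_subspace n B" and "B \<subset> A"
  shows "CARD('a) * card B \<le> card A"
proof -
  obtain a where a: "a \<in> A" "a \<notin> B" using assms(3) by blast
  have "card (line_ext B a) \<le> card A"
    using card_mono[OF finite_lin_subspace[OF A] line_ext_subset[OF A]] assms(3) a by blast
  then show ?thesis using card_line_ext[OF B] a lin_subspaceD(3)[OF A] by simp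
qed

text \<open>A maximal proper subspace \<open>B\<close> will do: any \<open>a\<close> of
  \<open>A\<close> outside it extends it to a larger subspace of \<open>A\<close>, which by
  maximality is \<open>A\<close>. Inductions on subspaces use this to peel off one vector.\<close>

lemma obtain_hyperplane:
  fixes A :: "'a::{field,finite} vec set"
  assumes A: "lin_subspace n A" and "A \<noteq> {0\<^sub>v n}"
  obtains B a where "lin_subspace n B" "B \<subset> A" "a \<in> A" "a \<notin> B" "A = line_ext B a"
    "card A = CARD('a) * card B"
proof -
  let ?S = "{B. lin_subspace n B \<and> B \<subset> A}"
  have "finite ?S"
    by (rule finite_subset[of _ "Pow A"]) (use finite_lin_subspace[OF A] in auto)
  moreover have "{0\<^sub>v n} \<in> ?S" using lin_subspace_zero lin_subspaceD(2)[OF A] assms(2) by auto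
  ultimately obtain B where B: "B \<in> ?S" and max: "\<And>C. C \<in> ?S \<Longrightarrow> B \<le> C \<Longrightarrow> B = C"
    using finite_has_maximal[of ?S] by (metis (no_types, lifting) empty_iff)
  obtain a where a: "a \<in> A" "a \<notin> B" using B by blast
  have aV: "a \<in> carrier_vec n" using lin_subspaceD(3)[OF A a(1)] .
  have sB: "lin_subspace n B" using B by simp
  have "line_ext B a \<subseteq> A" using line_ext_subset[OF A] B a by blast
  moreover have "\<not> line_ext B a \<subset> A"
    using max[of "line_ext B a"] subset_line_ext[OF sB aV] a lin_subspace_line_ext[OF sB aV] by blast
  ultimately have "A = line_ext B a" by blast
  then show ?thesis using that[of B a] B a card_line_ext[OF sB aV a(2)] by simp
qed

lemma card_geq_field:
  fixes A :: "'a::{field,finite} vec set"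
  assumes A: "lin_subspace n A" and "A \<noteq> {0\<^sub>v n}"
  shows "CARD('a) \<le> card A"
  using card_proper_subspace[OF A lin_subspace_zero] lin_subspaceD(2)[OF A] assms(2) by auto

subsection \<open>Alternating forms\<close>

locale alternating_form =
  fixes n :: nat and b :: "'a::{field,finite} vec \<Rightarrow> 'a vec \<Rightarrow> 'a"
  assumes add_left: "\<And>x y z. x \<in> carrier_vec n \<Longrightarrow> y \<in> carrier_vec n \<Longrightarrow> z \<in> carrier_vec n \<Longrightarrow>
      b (x + y) z = b x z + b y z"
    and smult_left: "\<And>c x z. x \<in> carrier_vec n \<Longrightarrow> z \<in> carrier_vec n \<Longrightarrow> b (c \<cdot>\<^sub>v x) z = c * b x z"
    and alternating: "\<And>x. x \<in> carrier_vec n \<Longrightarrow> b x x = 0"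
    and add_right: "\<And>x y z. x \<in> carrier_vec n \<Longrightarrow> y \<in> carrier_vec n \<Longrightarrow> z \<in> carrier_vec n \<Longrightarrow>
      b x (y + z) = b x y + b x z"
    and smult_right: "\<And>c x z. x \<in> carrier_vec n \<Longrightarrow> z \<in> carrier_vec n \<Longrightarrow> b x (c \<cdot>\<^sub>v z) = c * b x z"
begin

lemma skew:
  assumes "x \<in> carrier_vec n" "y \<in> carrier_vec n"
  shows "b x y = - b y x"
proof -
  have "0 = b (x + y) (x + y)" using assms by (simp add: alternating)
  also have "\<dots> = b x x + b x y + (b y x + b y y)" using assms by (simp add: add_left add_right)
  finally show ?thesis using assms by (simp add: alternating eq_neg_iff_add_eq_0)
qed

lemma zero_left: "x \<in> carrier_vec n \<Longrightarrow> b (0\<^sub>v n) x = 0"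
  using add_left[of "0\<^sub>v n" "0\<^sub>v n" x]
  by (metis add_cancel_right_right left_zero_vec zero_carrier_vec)

lemma zero_right: "x \<in> carrier_vec n \<Longrightarrow> b x (0\<^sub>v n) = 0"
  using add_right[of x "0\<^sub>v n" "0\<^sub>v n"]
  by (metis add_cancel_right_right left_zero_vec zero_carrier_vec)

lemma minus_left:
  assumes "x \<in> carrier_vec n" "y \<in> carrier_vec n" "z \<in> carrier_vec n"
  shows "b (x - y) z = b x z - b y z"
proof -
  have "x - y = x + (-1) \<cdot>\<^sub>v y" using assms by (intro eq_vecI) auto
  then show ?thesis using assms by (simp add: add_left smult_left)
qed

lemma minus_right:
  assumes "x \<in> carrier_vec n" "y \<in> carrier_vec n" "z \<in> carrier_vec n"
  shows "b x (y - z) = b x y - b x z"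
proof -
  have "y - z = y + (-1) \<cdot>\<^sub>v z" using assms by (intro eq_vecI) auto
  then show ?thesis using assms by (simp add: add_right smult_right)
qed

lemmas bilinear = add_left add_right smult_left smult_right minus_left minus_right zero_left zero_right

lemma orth_sym: "x \<in> carrier_vec n \<Longrightarrow> y \<in> carrier_vec n \<Longrightarrow> b x y = 0 \<longleftrightarrow> b y x = 0"
  using skew[of x y] by simp

definition nondegenerate :: "'a vec set \<Rightarrow> bool" where
  "nondegenerate U \<longleftrightarrow> (\<forall>x\<in>U. (\<forall>y\<in>U. b x y = 0) \<longrightarrow> x = 0\<^sub>v n)"

definition perp :: "'a vec set \<Rightarrow> 'a vec set" where
  "perp A = {x \<in> carrier_vec n. \<forall>y\<in>A. b y x = 0}"

definition radical :: "'a vec set \<Rightarrow> 'a vec set" where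
  "radical W = {x \<in> W. \<forall>y\<in>W. b x y = 0}"

lemma lin_subspace_perp: "A \<subseteq> carrier_vec n \<Longrightarrow> lin_subspace n (perp A)"
  by (rule lin_subspaceI) (auto simp: perp_def bilinear subset_iff)

lemma lin_subspace_radical:
  assumes "lin_subspace n W"
  shows "lin_subspace n (radical W)"
  by (rule lin_subspaceI) (auto simp: radical_def bilinear lin_subspaceD[OF assms])

text \<open>Contrapositively, the double perp of \<open>A\<close> lies in \<open>A\<close>. The
  induction writes \<open>A\<close> as a hyperplane \<open>B\<close> extended by \<open>c\<close>,
  separates from \<open>B\<close> first \<open>c\<close> and then a modification of
  \<open>a\<close>, and combines the two vectors found.\<close>

lemma separating_vector:
  assumes nd: "nondegenerate (carrier_vec n)" and A: "lin_subspace n A"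
    and a: "a \<in> carrier_vec n" "a \<notin> A"
  obtains x where "x \<in> perp A" "b a x \<noteq> 0"
proof -
  have "\<exists>x\<in>perp A. b a x \<noteq> 0" using A a
  proof (induction "card A" arbitrary: A a rule: less_induct)
    case less
    show ?case
    proof (cases "A = {0\<^sub>v n}")
      case True
      then have "\<exists>x\<in>carrier_vec n. b a x \<noteq> 0"
        using nd less.prems by (auto simp: nondegenerate_def)
      then show ?thesis using True by (auto simp: perp_def zero_left)
    next
      case False
      obtain B c where B: "lin_subspace n B" "B \<subset> A" "c \<in> A" "c \<notin> B" "A = line_ext B c"
        using obtain_hyperplane[OF less.prems(1) False] by metis
      note DB = lin_subspaceD[OF B(1)]
      have cV: "c \<in> carrier_vec n" using lin_subspaceD(3)[OF less.prems(1) B(3)] .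
      have lt: "card B < card A"
        using psubset_card_mono[OF finite_lin_subspace[OF less.prems(1)] B(2)] .
      obtain x where x: "x \<in> perp B" "b c x \<noteq> 0"
        using less.hyps[OF lt B(1) cV B(4)] by blast
      have xV: "x \<in> carrier_vec n" and xB: "\<And>y. y \<in> B \<Longrightarrow> b y x = 0" using x by (auto simp: perp_def)
      \<comment> \<open>This value makes \<open>a - d \<cdot>\<^sub>v c\<close> orthogonal to
        \<open>x\<close>, so that correcting \<open>y\<close> by a multiple of \<open>x\<close> does
        not change its pairing with that vector.\<close>
      define d where "d = b a x / b c x"
      have "a - d \<cdot>\<^sub>v c \<notin> B"
      proof
        assume h: "a - d \<cdot>\<^sub>v c \<in> B"
        have "a = (a - d \<cdot>\<^sub>v c) + d \<cdot>\<^sub>v c" using less.prems cV by (intro eq_vecI) auto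
        then have "a \<in> line_ext B c" using h unfolding line_ext_def by blast
        then show False using B less.prems by simp
      qed
      then obtain y where y: "y \<in> perp B" "b (a - d \<cdot>\<^sub>v c) y \<noteq> 0"
        using less.hyps[OF lt B(1)] less.prems(2) cV by (meson minus_carrier_vec smult_carrier_vec)
      have yV: "y \<in> carrier_vec n" and yB: "\<And>z. z \<in> B \<Longrightarrow> b z y = 0" using y by (auto simp: perp_def)
      \<comment> \<open>The multiple of \<open>x\<close> is chosen so that \<open>z\<close> is
        orthogonal to \<open>c\<close> as well as to \<open>B\<close>; hence \<open>a\<close> and
        \<open>a - d \<cdot>\<^sub>v c\<close> pair equally with \<open>z\<close>.\<close>
      define z where "z = y - (b c y / b c x) \<cdot>\<^sub>v x"
      have "b a z \<noteq> 0"
        using y(2) x(2) less.prems(2) cV xV yV by (simp add: z_def d_def bilinear field_simps)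
      moreover have "z \<in> perp A"
        using x(2) cV xV yV xB yB DB(3) by (auto simp: B(5) line_ext_def perp_def z_def bilinear)
      ultimately show ?thesis by blast
    qed
  qed
  then show ?thesis using that by blast
qed

section \<open>Isometries and the splitting off of a hyperbolic plane\<close>

definition isometry_on :: "('a vec \<Rightarrow> 'a vec) \<Rightarrow> 'a vec set \<Rightarrow> 'a vec set \<Rightarrow> bool" where
  "isometry_on g U U' \<longleftrightarrow> bij_betw g U U' \<and> (\<forall>x\<in>U. \<forall>y\<in>U. g (x + y) = g x + g y) \<and>
     (\<forall>c. \<forall>x\<in>U. g (c \<cdot>\<^sub>v x) = c \<cdot>\<^sub>v g x) \<and> (\<forall>x\<in>U. \<forall>y\<in>U. b (g x) (g y) = b x y)"

definition hyperbolic_pair :: "'a vec \<Rightarrow> 'a vec \<Rightarrow> bool" where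
  "hyperbolic_pair e f \<longleftrightarrow> e \<in> carrier_vec n \<and> f \<in> carrier_vec n \<and> b e f = 1"

definition orth_part :: "'a vec \<Rightarrow> 'a vec \<Rightarrow> 'a vec set \<Rightarrow> 'a vec set" where
  "orth_part e f U = {x \<in> U. b x e = 0 \<and> b x f = 0}"

definition comb :: "'a vec \<Rightarrow> 'a vec \<Rightarrow> 'a \<Rightarrow> 'a \<Rightarrow> 'a vec \<Rightarrow> 'a vec" where
  "comb e f \<alpha> \<beta> w = \<alpha> \<cdot>\<^sub>v e + \<beta> \<cdot>\<^sub>v f + w"

text \<open>If \<open>x\<close> is \<open>comb e f \<alpha> \<beta> w\<close> with \<open>w\<close>
  orthogonal to the plane, then \<open>b x f\<close> is \<alpha> and \<open>b e x\<close> is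
  \<beta>. Subtracting the plane component leaves \<open>w\<close>; the differing argument orders
  avoid a sign.\<close>

definition proj :: "'a vec \<Rightarrow> 'a vec \<Rightarrow> 'a vec \<Rightarrow> 'a vec" where
  "proj e f x = x - (b x f \<cdot>\<^sub>v e + b e x \<cdot>\<^sub>v f)"

context
  fixes e f assumes ef: "hyperbolic_pair e f"
begin

lemma hyperbolic_pairD: "e \<in> carrier_vec n" "f \<in> carrier_vec n" "b e f = 1" "b f e = - 1" "b e e = 0" "b f f = 0"
  using ef skew[of f e] alternating by (auto simp: hyperbolic_pair_def)

lemma orth_partD:
  assumes "w \<in> orth_part e f (carrier_vec n)"
  shows "w \<in> carrier_vec n" "b w e = 0" "b w f = 0" "b e w = 0" "b f w = 0"
  using assms orth_sym[of w e] orth_sym[of w f] hyperbolic_pairD by (auto simp: orth_part_def)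

lemma comb_coords:
  assumes "w \<in> orth_part e f (carrier_vec n)"
  shows "b (comb e f \<alpha> \<beta> w) f = \<alpha>" "b e (comb e f \<alpha> \<beta> w) = \<beta>" "b (comb e f \<alpha> \<beta> w) e = - \<beta>"
    "proj e f (comb e f \<alpha> \<beta> w) = w"
proof -
  show 1: "b (comb e f \<alpha> \<beta> w) f = \<alpha>" "b e (comb e f \<alpha> \<beta> w) = \<beta>" "b (comb e f \<alpha> \<beta> w) e = - \<beta>"
    using hyperbolic_pairD orth_partD[OF assms] by (auto simp: comb_def bilinear)
  show "proj e f (comb e f \<alpha> \<beta> w) = w" unfolding proj_def 1 unfolding comb_def
    using hyperbolic_pairD orth_partD[OF assms] by (intro eq_vecI) auto
qed

lemma proj_orth:
  assumes "x \<in> carrier_vec n"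
  shows "proj e f x \<in> orth_part e f (carrier_vec n)"
  using hyperbolic_pairD assms by (auto simp: proj_def orth_part_def bilinear skew[of x e])

lemma comb_proj:
  assumes "x \<in> carrier_vec n"
  shows "comb e f (b x f) (b e x) (proj e f x) = x"
  using hyperbolic_pairD assms by (intro eq_vecI) (auto simp: proj_def comb_def)

text \<open>Plane and complement are orthogonal, so only the determinant of the plane coordinates
  and the form on the complement survive.\<close>

lemma form_comb:
  assumes "w \<in> orth_part e f (carrier_vec n)" "w' \<in> orth_part e f (carrier_vec n)"
  shows "b (comb e f \<alpha> \<beta> w) (comb e f \<alpha>' \<beta>' w') = \<alpha> * \<beta>' - \<beta> * \<alpha>' + b w w'"
  using hyperbolic_pairD orth_partD[OF assms(1)] orth_partD[OF assms(2)]
  by (simp add: comb_def bilinear)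

lemma comb_add:
  assumes "w \<in> carrier_vec n" "w' \<in> carrier_vec n"
  shows "comb e f (\<alpha> + \<alpha>') (\<beta> + \<beta>') (w + w') = comb e f \<alpha> \<beta> w + comb e f \<alpha>' \<beta>' w'"
  using assms hyperbolic_pairD by (intro eq_vecI) (auto simp: comb_def algebra_simps)

lemma comb_smult:
  assumes "w \<in> carrier_vec n"
  shows "comb e f (c * \<alpha>) (c * \<beta>) (c \<cdot>\<^sub>v w) = c \<cdot>\<^sub>v comb e f \<alpha> \<beta> w"
  using assms hyperbolic_pairD by (intro eq_vecI) (auto simp: comb_def algebra_simps)

lemma proj_add:
  assumes "x \<in> carrier_vec n" "y \<in> carrier_vec n"
  shows "proj e f (x + y) = proj e f x + proj e f y"
  using assms hyperbolic_pairD by (intro eq_vecI) (auto simp: proj_def bilinear algebra_simps)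

lemma proj_smult:
  assumes "x \<in> carrier_vec n"
  shows "proj e f (c \<cdot>\<^sub>v x) = c \<cdot>\<^sub>v proj e f x"
  using assms hyperbolic_pairD by (intro eq_vecI) (auto simp: proj_def bilinear algebra_simps)

lemma comb_mem:
  assumes "lin_subspace n U" "e \<in> U" "f \<in> U" "w \<in> U"
  shows "comb e f \<alpha> \<beta> w \<in> U"
  using lin_subspaceD(5,6)[OF assms(1)] assms(2-) by (simp add: comb_def)

lemma proj_mem:
  assumes "lin_subspace n U" "e \<in> U" "f \<in> U" "x \<in> U"
  shows "proj e f x \<in> orth_part e f U"
proof -
  have "proj e f x \<in> U" unfolding proj_def
    using assms(2-) by (intro lin_subspaceD(5-7)[OF assms(1)])
  then show ?thesis using proj_orth[OF lin_subspaceD(3)[OF assms(1,4)]] by (simp add: orth_part_def)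
qed

lemma lin_subspace_orth_part:
  assumes "lin_subspace n U"
  shows "lin_subspace n (orth_part e f U)"
  by (rule lin_subspaceI)
    (use hyperbolic_pairD in \<open>auto simp: orth_part_def bilinear lin_subspaceD[OF assms]\<close>)

lemma orth_part_mono: "U \<subseteq> U' \<Longrightarrow> orth_part e f U \<subseteq> orth_part e f U'"
  by (auto simp: orth_part_def)

text \<open>A vector of the complement is orthogonal to \<open>e\<close> and \<open>f\<close>
  anyway; if it is orthogonal to the complement too, it is orthogonal to all of
  \<open>U\<close>.\<close>

lemma nondegenerate_orth_part:
  assumes U: "lin_subspace n U" "e \<in> U" "f \<in> U" "nondegenerate U"
  shows "nondegenerate (orth_part e f U)"
  unfolding nondegenerate_def
proof (intro ballI impI)
  fix x assume x: "x \<in> orth_part e f U" and h: "\<forall>y\<in>orth_part e f U. b x y = 0"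
  have xo: "x \<in> orth_part e f (carrier_vec n)" using x lin_subspaceD(3)[OF U(1)] by (simp add: orth_part_def)
  have "b x y = 0" if y: "y \<in> U" for y
  proof -
    have yV: "y \<in> carrier_vec n" using lin_subspaceD(3)[OF U(1) y] .
    have "b x y = b x (comb e f (b y f) (b e y) (proj e f y))" using comb_proj[OF yV] by simp
    also have "\<dots> = b x (proj e f y)"
      using orth_partD[OF xo] hyperbolic_pairD orth_partD[OF proj_orth[OF yV]] by (simp add: comb_def bilinear)
    finally show ?thesis using h proj_mem[OF U(1-3) y] by simp
  qed
  then show "x = 0\<^sub>v n" using U(4) x by (auto simp: nondegenerate_def orth_part_def)
qed

text \<open>\<open>W\<close> decomposes into a part in the plane and a part in its complement. The
  plane part is recorded by coordinates in \<open>D\<close>, a set that does not mention the pair,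
  so that subspaces adapted to different pairs can be compared.\<close>

definition splits :: "('a \<times> 'a) set \<Rightarrow> 'a vec set \<Rightarrow> bool" where
  "splits D W \<longleftrightarrow> (\<forall>\<alpha> \<beta>. \<forall>w\<in>orth_part e f (carrier_vec n). comb e f \<alpha> \<beta> w \<in> W \<longleftrightarrow> (\<alpha>, \<beta>) \<in> D \<and> w \<in> W)"

text \<open>Plane coordinates together with the projection identify \<open>W\<close> with
  \<open>D \<times> orth_part e f W\<close>. Inductions use this to cancel the plane.\<close>

lemma card_splits:
  assumes W: "W \<subseteq> carrier_vec n" and sp: "splits D W"
  shows "card W = card D * card (orth_part e f W)"
proof -
  have "bij_betw (\<lambda>x. ((b x f, b e x), proj e f x)) W (D \<times> orth_part e f W)"
  proof (rule bij_betwI[where g = "\<lambda>(p, w). comb e f (fst p) (snd p) w"])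
    show "(\<lambda>x. ((b x f, b e x), proj e f x)) \<in> W \<rightarrow> D \<times> orth_part e f W"
    proof
      fix x assume x: "x \<in> W"
      then have xV: "x \<in> carrier_vec n" using W by blast
      have "comb e f (b x f) (b e x) (proj e f x) \<in> W" using comb_proj[OF xV] x by simp
      then show "((b x f, b e x), proj e f x) \<in> D \<times> orth_part e f W"
        using sp proj_orth[OF xV] by (auto simp: splits_def orth_part_def)
    qed
    show "(\<lambda>(p, w). comb e f (fst p) (snd p) w) \<in> D \<times> orth_part e f W \<rightarrow> W"
      using sp orth_part_mono[OF W] by (auto simp: splits_def orth_part_def)
  qed (use W comb_coords comb_proj orth_part_mono[OF W] in auto)
  from bij_betw_same_card[OF this] show ?thesis by (simp add: card_cartesian_product)
qed

lemma splits_full: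
  assumes "lin_subspace n U" "e \<in> U" "f \<in> U"
  shows "splits UNIV U"
proof -
  have "w \<in> U" if "comb e f \<alpha> \<beta> w \<in> U" "w \<in> orth_part e f (carrier_vec n)" for \<alpha> \<beta> w
    using proj_mem[OF assms that(1)] comb_coords(4)[OF that(2)] by (simp add: orth_part_def)
  then show ?thesis unfolding splits_def using comb_mem[OF assms] by blast
qed

text \<open>Every vector of \<open>W\<close> is orthogonal to \<open>e\<close>, so its coordinate
  along \<open>f\<close> vanishes, while multiples of \<open>e\<close> can be added and removed
  freely.\<close>

lemma splits_isotropic:
  assumes W: "lin_subspace n W" "e \<in> W" and ti: "radical W = W"
  shows "splits (UNIV \<times> {0}) W"
proof -
  note D = lin_subspaceD[OF W(1)]
  have "\<beta> = 0 \<and> w \<in> W" if x: "comb e f \<alpha> \<beta> w \<in> W" and w: "w \<in> orth_part e f (carrier_vec n)" for \<alpha> \<beta> w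
  proof -
    have "\<beta> = b e (comb e f \<alpha> \<beta> w)" using comb_coords(2)[OF w] by simp
    also have "\<dots> = 0" using ti x W(2) by (auto simp: radical_def)
    finally have "\<beta> = 0" .
    moreover have "w = comb e f \<alpha> 0 w - \<alpha> \<cdot>\<^sub>v e"
      using orth_partD[OF w] hyperbolic_pairD by (intro eq_vecI) (auto simp: comb_def)
    ultimately show ?thesis using x D(6)[OF W(2)] D(7) by metis
  qed
  moreover have "comb e f \<alpha> 0 w \<in> W" if "w \<in> W" for \<alpha> w
  proof -
    have "comb e f \<alpha> 0 w = \<alpha> \<cdot>\<^sub>v e + w" using D(4)[OF that] hyperbolic_pairD by (intro eq_vecI) (auto simp: comb_def)
    then show ?thesis using D(5) D(6)[OF W(2)] that by simp
  qed
  ultimately show ?thesis by (auto simp: splits_def)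
qed

lemma splits_zero: "splits {(0, 0)} {0\<^sub>v n}"
proof -
  have "\<alpha> = 0 \<and> \<beta> = 0 \<and> w = 0\<^sub>v n" if w: "w \<in> orth_part e f (carrier_vec n)" and x: "comb e f \<alpha> \<beta> w = 0\<^sub>v n" for \<alpha> \<beta> w
    using comb_coords(1,2)[OF w, of \<alpha> \<beta>] comb_coords(4)[OF w, of \<alpha> \<beta>] unfolding x
    using hyperbolic_pairD by (auto simp: zero_left zero_right proj_def)
  moreover have "comb e f 0 0 (0\<^sub>v n) = 0\<^sub>v n" using hyperbolic_pairD by (intro eq_vecI) (auto simp: comb_def)
  ultimately show ?thesis by (auto simp: splits_def)
qed

text \<open>Since \<open>e\<close> and \<open>f\<close> lie in \<open>W\<close>, the radical of
  \<open>W\<close> is contained in the complement. Conversely, what is orthogonal to the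
  complement's part of \<open>W\<close> and to the plane is orthogonal to \<open>W\<close>.\<close>

lemma radical_orth_part_full:
  assumes W: "lin_subspace n W" "e \<in> W" "f \<in> W"
  shows "radical (orth_part e f W) = radical W"
proof
  show "radical W \<subseteq> radical (orth_part e f W)" using W by (auto simp: radical_def orth_part_def)
  show "radical (orth_part e f W) \<subseteq> radical W"
  proof
    fix x assume x: "x \<in> radical (orth_part e f W)"
    have xo: "x \<in> orth_part e f (carrier_vec n)"
      using x lin_subspaceD(3)[OF W(1)] by (auto simp: radical_def orth_part_def)
    have "b x y = 0" if y: "y \<in> W" for y
    proof -
      have yV: "y \<in> carrier_vec n" using lin_subspaceD(3)[OF W(1) y] .
      have "b x y = b x (comb e f (b y f) (b e y) (proj e f y))" using comb_proj[OF yV] by simp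
      also have "\<dots> = b x (proj e f y)"
        using orth_partD[OF xo] hyperbolic_pairD orth_partD[OF proj_orth[OF yV]] by (simp add: comb_def bilinear)
      finally show ?thesis using x proj_mem[OF W y] by (simp add: radical_def)
    qed
    then show "x \<in> radical W" using x by (auto simp: radical_def orth_part_def)
  qed
qed

end

section \<open>Extension of isometries across a hyperbolic plane\<close>

lemma isometry_onD:
  assumes "isometry_on g U U'"
  shows "bij_betw g U U'" "x \<in> U \<Longrightarrow> g x \<in> U'" "x \<in> U \<Longrightarrow> y \<in> U \<Longrightarrow> g (x + y) = g x + g y"
    "x \<in> U \<Longrightarrow> g (c \<cdot>\<^sub>v x) = c \<cdot>\<^sub>v g x" "x \<in> U \<Longrightarrow> y \<in> U \<Longrightarrow> b (g x) (g y) = b x y"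
  using assms by (auto simp: isometry_on_def bij_betw_def)

text \<open>The map \<open>h\<close> keeps the plane coordinates, so it sends \<open>e\<close> to
  \<open>e'\<close> and \<open>f\<close> to \<open>f'\<close>, and it acts as \<open>g\<close> on
  the complement. Its inverse is built in the same way from the inverse of \<open>g\<close>, and
  \<open>form_comb\<close> shows that the form is preserved.\<close>

lemma isometry_extend:
  assumes ef: "hyperbolic_pair e f" "hyperbolic_pair e' f'"
    and U: "lin_subspace n U" "e \<in> U" "f \<in> U"
    and U': "lin_subspace n U'" "e' \<in> U'" "f' \<in> U'"
    and g: "isometry_on g (orth_part e f U) (orth_part e' f' U')"
  defines "h \<equiv> \<lambda>x. comb e' f' (b x f) (b e x) (g (proj e f x))"
  shows "isometry_on h U U'"
proof -
  note gD = isometry_onD[OF g]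
  note UV = lin_subspaceD(3)[OF U(1)] and UV' = lin_subspaceD(3)[OF U'(1)]
  note P = proj_mem[OF ef(1) U] and P' = proj_mem[OF ef(2) U']
  have sub: "orth_part e f U \<subseteq> orth_part e f (carrier_vec n)"
    "orth_part e' f' U' \<subseteq> orth_part e' f' (carrier_vec n)"
    using UV UV' by (auto simp: orth_part_def)
  have gP: "g (proj e f x) \<in> orth_part e' f' U'" if "x \<in> U" for x using gD(2)[OF P[OF that]] .
  have gPo: "g (proj e f x) \<in> orth_part e' f' (carrier_vec n)" if "x \<in> U" for x using gP[OF that] sub by blast
  have gPV: "g (proj e f x) \<in> carrier_vec n" if "x \<in> U" for x using gPo[OF that] by (simp add: orth_part_def)
  define g' where "g' = inv_into (orth_part e f U) g"
  have g'm: "g' w \<in> orth_part e f U" and gg': "g (g' w) = w" if "w \<in> orth_part e' f' U'" for w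
    using gD(1) that by (auto simp: g'_def bij_betw_def inv_into_into f_inv_into_f)
  have g'g: "g' (g w) = w" if "w \<in> orth_part e f U" for w
    using gD(1) that by (simp add: g'_def bij_betw_def)
  have "bij_betw h U U'"
  proof (rule bij_betwI[where g = "\<lambda>y. comb e f (b y f') (b e' y) (g' (proj e' f' y))"])
    show "h \<in> U \<rightarrow> U'"
      using comb_mem[OF ef(2) U'] gP by (auto simp: h_def orth_part_def)
    show "(\<lambda>y. comb e f (b y f') (b e' y) (g' (proj e' f' y))) \<in> U' \<rightarrow> U"
      using comb_mem[OF ef(1) U] g'm[OF P'] by (auto simp: orth_part_def)
    show "comb e f (b (h x) f') (b e' (h x)) (g' (proj e' f' (h x))) = x" if x: "x \<in> U" for x
      unfolding h_def comb_coords[OF ef(2) gPo[OF x]] g'g[OF P[OF x]] comb_proj[OF ef(1) UV[OF x]] ..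
    show "h (comb e f (b y f') (b e' y) (g' (proj e' f' y))) = y" if y: "y \<in> U'" for y
    proof -
      have w: "g' (proj e' f' y) \<in> orth_part e f (carrier_vec n)" using g'm[OF P'[OF y]] sub by blast
      show ?thesis
        unfolding h_def comb_coords[OF ef(1) w] gg'[OF P'[OF y]] comb_proj[OF ef(2) UV'[OF y]] ..
    qed
  qed
  moreover have "h (x + y) = h x + h y" if "x \<in> U" "y \<in> U" for x y
    using that UV hyperbolic_pairD[OF ef(1)] comb_add[OF ef(2) gPV[OF that(1)] gPV[OF that(2)]]
    by (simp add: h_def proj_add[OF ef(1)] bilinear gD(3)[OF P[OF that(1)] P[OF that(2)]])
  moreover have "h (c \<cdot>\<^sub>v x) = c \<cdot>\<^sub>v h x" if "x \<in> U" for c x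
    using that UV hyperbolic_pairD[OF ef(1)] comb_smult[OF ef(2) gPV[OF that]]
    by (simp add: h_def proj_smult[OF ef(1)] bilinear gD(4)[OF P[OF that]])
  moreover have "b (h x) (h y) = b x y" if xy: "x \<in> U" "y \<in> U" for x y
  proof -
    have "b (h x) (h y) = b x f * b e y - b e x * b y f + b (g (proj e f x)) (g (proj e f y))"
      unfolding h_def by (rule form_comb[OF ef(2) gPo[OF xy(1)] gPo[OF xy(2)]])
    also have "b (g (proj e f x)) (g (proj e f y)) = b (proj e f x) (proj e f y)"
      by (rule gD(5)[OF P[OF xy(1)] P[OF xy(2)]])
    also have "b x f * b e y - b e x * b y f + b (proj e f x) (proj e f y) =
        b (comb e f (b x f) (b e x) (proj e f x)) (comb e f (b y f) (b e y) (proj e f y))"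
      by (rule form_comb[OF ef(1) proj_orth[OF ef(1) UV[OF xy(1)]] proj_orth[OF ef(1) UV[OF xy(2)]], symmetric])
    finally show ?thesis by (simp add: comb_proj[OF ef(1)] UV xy)
  qed
  ultimately show ?thesis by (simp add: isometry_on_def)
qed

text \<open>Both subspaces have the same coordinate set \<open>D\<close>, so keeping coordinates
  matches their plane parts, and \<open>g\<close> matches the rest.\<close>

lemma isometry_extend_image:
  assumes ef: "hyperbolic_pair e f" "hyperbolic_pair e' f'"
    and W: "W \<subseteq> carrier_vec n" "splits e f D W" and W': "W' \<subseteq> carrier_vec n" "splits e' f' D W'"
    and g: "g ` orth_part e f W = orth_part e' f' W'"
  shows "(\<lambda>x. comb e' f' (b x f) (b e x) (g (proj e f x))) ` W = W'"
proof -
  have sub: "orth_part e f W \<subseteq> orth_part e f (carrier_vec n)"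
    "orth_part e' f' W' \<subseteq> orth_part e' f' (carrier_vec n)"
    using W W' by (auto simp: orth_part_def)
  \<comment> \<open>Stated for an arbitrary pair and subspace, because it is needed on the source
    side and on the target side.\<close>
  have mem: "(b x f, b e x) \<in> D \<and> proj e f x \<in> orth_part e f W"
    if x: "x \<in> W" and p: "hyperbolic_pair e f" "W \<subseteq> carrier_vec n" "splits e f D W" for x e f W
  proof -
    have xV: "x \<in> carrier_vec n" using x p by blast
    have "(b x f, b e x) \<in> D \<and> proj e f x \<in> W"
      using p(3) proj_orth[OF p(1) xV] comb_proj[OF p(1) xV] x unfolding splits_def[OF p(1)] by metis
    then show ?thesis using proj_orth[OF p(1) xV] by (simp add: orth_part_def)
  qed
  show ?thesis
  proof
    show "(\<lambda>x. comb e' f' (b x f) (b e x) (g (proj e f x))) ` W \<subseteq> W'"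
    proof
      fix y assume "y \<in> (\<lambda>x. comb e' f' (b x f) (b e x) (g (proj e f x))) ` W"
      then obtain x where x: "x \<in> W" "y = comb e' f' (b x f) (b e x) (g (proj e f x))" by blast
      have m: "(b x f, b e x) \<in> D" "proj e f x \<in> orth_part e f W" using mem[OF x(1) ef(1) W] by auto
      then have w: "g (proj e f x) \<in> orth_part e' f' W'" using g by blast
      then have "g (proj e f x) \<in> orth_part e' f' (carrier_vec n)" "g (proj e f x) \<in> W'"
        using sub by (auto simp: orth_part_def)
      then show "y \<in> W'" using W'(2) m(1) x(2) unfolding splits_def[OF ef(2)] by blast
    qed
    show "W' \<subseteq> (\<lambda>x. comb e' f' (b x f) (b e x) (g (proj e f x))) ` W"
    proof
      fix y assume y: "y \<in> W'"
      have m: "(b y f', b e' y) \<in> D" "proj e' f' y \<in> orth_part e' f' W'" using mem[OF y ef(2) W'] by auto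
      then obtain w where w: "w \<in> orth_part e f W" "g w = proj e' f' y" using g by force
      have wo: "w \<in> orth_part e f (carrier_vec n)" "w \<in> W" using w sub by (auto simp: orth_part_def)
      let ?x = "comb e f (b y f') (b e' y) w"
      have "?x \<in> W" using W(2) m(1) wo unfolding splits_def[OF ef(1)] by blast
      moreover have "y = comb e' f' (b ?x f) (b e ?x) (g (proj e f ?x))"
        unfolding comb_coords[OF ef(1) wo(1)] w(2) using comb_proj[OF ef(2)] W' y by auto
      ultimately show "y \<in> (\<lambda>x. comb e' f' (b x f) (b e x) (g (proj e f x))) ` W" by blast
    qed
  qed
qed

section \<open>Witt transitivity\<close>

lemma hyperbolic_pairI:
  assumes "x \<in> carrier_vec n" "y \<in> carrier_vec n" "b x y \<noteq> 0"
  shows "hyperbolic_pair x (inverse (b x y) \<cdot>\<^sub>v y)"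
  using assms by (simp add: hyperbolic_pair_def smult_right)

text \<open>The coordinates, along a hyperbolic pair adapted to \<open>W\<close>, of the part of \<open>W\<close> inside the hyperbolic
  plane: everything if \<open>W\<close> is not totally isotropic, else a line, or zero if \<open>W\<close> is zero. The shape depends
  only on the cardinalities of \<open>W\<close> and its radical, hence agrees for two subspaces of equal type.\<close>

definition shape :: "'a vec set \<Rightarrow> ('a \<times> 'a) set" where
  "shape W = (if radical W \<noteq> W then UNIV else if W \<noteq> {0\<^sub>v n} then UNIV \<times> {0} else {(0, 0)})"

text \<open>If the form does not vanish on \<open>W\<close>, the pair is taken inside
  \<open>W\<close>. If \<open>W\<close> is totally isotropic and nonzero, \<open>e\<close> is taken
  in \<open>W\<close> and nondegeneracy of \<open>U\<close> supplies \<open>f\<close>; if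
  \<open>W\<close> is zero, any pair of \<open>U\<close> serves. The last conclusion tracks the
  radical through the induction: it is unchanged in the first case, and what remains of
  \<open>W\<close> is again totally isotropic in the others.\<close>

lemma obtain_adapted_pair:
  assumes U: "lin_subspace n U" "nondegenerate U" "U \<noteq> {0\<^sub>v n}" and W: "lin_subspace n W" "W \<subseteq> U"
  obtains e f where "hyperbolic_pair e f" "e \<in> U" "f \<in> U" "splits e f (shape W) W"
    "radical (orth_part e f W) = (if radical W \<noteq> W then radical W else orth_part e f W)"
proof -
  note UD = lin_subspaceD[OF U(1)] and WD = lin_subspaceD[OF W(1)]
  have ex: "\<exists>f\<in>U. hyperbolic_pair e f" if e: "e \<in> U" "e \<noteq> 0\<^sub>v n" for e
  proof -
    obtain y where y: "y \<in> U" "b e y \<noteq> 0" using U(2) e unfolding nondegenerate_def by blast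
    then show ?thesis using hyperbolic_pairI[OF UD(3)[OF e(1)] UD(3)[OF y(1)] y(2)] UD(6)[OF y(1)] by blast
  qed
  have ti: "radical (orth_part e f W) = orth_part e f W" if "radical W = W" for e f
    using that by (fastforce simp: radical_def orth_part_def)
  show ?thesis
  proof (cases "radical W = W")
    case False
    then obtain x y where xy: "x \<in> W" "y \<in> W" "b x y \<noteq> 0" by (auto simp: radical_def)
    define f where "f = inverse (b x y) \<cdot>\<^sub>v y"
    have p: "hyperbolic_pair x f" unfolding f_def by (rule hyperbolic_pairI[OF WD(3)[OF xy(1)] WD(3)[OF xy(2)] xy(3)])
    have f: "f \<in> W" unfolding f_def by (rule WD(6)[OF xy(2)])
    show ?thesis
      using that[OF p] xy(1) f W(2) splits_full[OF p W(1) xy(1) f] radical_orth_part_full[OF p W(1) xy(1) f] False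
      by (auto simp: shape_def)
  next
    case True
    show ?thesis
    proof (cases "W = {0\<^sub>v n}")
      case False
      then obtain e where e: "e \<in> W" "e \<noteq> 0\<^sub>v n" using WD(2) by blast
      then obtain f where f: "f \<in> U" "hyperbolic_pair e f" using ex W(2) by blast
      show ?thesis
        using that[OF f(2) _ f(1)] e W(2) splits_isotropic[OF f(2) W(1) e(1) True] ti[OF True] True False
        by (auto simp: shape_def)
    next
      case W0: True
      obtain e where e: "e \<in> U" "e \<noteq> 0\<^sub>v n" using UD(2) U(3) by blast
      then obtain f where f: "f \<in> U" "hyperbolic_pair e f" using ex by blast
      show ?thesis
        using that[OF f(2) e(1) f(1)] splits_zero[OF f(2)] ti[OF True] True W0 by (simp add: shape_def)
    qed
  qed
qed

lemma radical_eq_iff_card: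
  assumes "lin_subspace n W"
  shows "radical W = W \<longleftrightarrow> card (radical W) = card W"
  using card_subset_eq[OF finite_lin_subspace[OF assms], of "radical W"] by (auto simp: radical_def)

text \<open>The ambient spaces are two arbitrary nondegenerate subspaces because the planes split
  off on the two sides, and hence their complements, differ in general. All hypotheses are
  cardinalities or nondegeneracy, which pass to the complements.\<close>

lemma witt_transitivity:
  assumes "lin_subspace n U" "nondegenerate U" "lin_subspace n U'" "nondegenerate U'" "card U = card U'"
    and "lin_subspace n W" "W \<subseteq> U" "lin_subspace n W'" "W' \<subseteq> U'" "card W = card W'"
    and "card (radical W) = card (radical W')"
  obtains g where "isometry_on g U U'" "g ` W = W'"
proof -
  have "\<exists>g. isometry_on g U U' \<and> g ` W = W'" using assms
  proof (induction "card U" arbitrary: U U' W W' rule: less_induct)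
    case less
    note U = less.prems(1,2) and U' = less.prems(3,4) and W = less.prems(6,7) and W' = less.prems(8,9)
    show ?case
    proof (cases "U = {0\<^sub>v n}")
      case True
      have "U' = {0\<^sub>v n}"
        using lin_subspace_card_eq_1[OF U'(1)] True less.prems(5) by simp
      moreover have "W = {0\<^sub>v n}" "W' = {0\<^sub>v n}"
        using lin_subspaceD(2)[OF W(1)] lin_subspaceD(2)[OF W'(1)] W(2) W'(2) True calculation by auto
      ultimately have "isometry_on (\<lambda>x. x) U U'" "(\<lambda>x. x) ` W = W'"
        using True by (auto simp: isometry_on_def)
      then show ?thesis by blast
    next
      case False
      then have "U' \<noteq> {0\<^sub>v n}"
        using lin_subspace_card_eq_1[OF U'(1)] lin_subspace_card_eq_1[OF U(1)] less.prems(5) by simp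
      then obtain e' f' where p': "hyperbolic_pair e' f'" "e' \<in> U'" "f' \<in> U'" "splits e' f' (shape W') W'"
        "radical (orth_part e' f' W') = (if radical W' \<noteq> W' then radical W' else orth_part e' f' W')"
        using obtain_adapted_pair[OF U' _ W'] by blast
      obtain e f where p: "hyperbolic_pair e f" "e \<in> U" "f \<in> U" "splits e f (shape W) W"
        "radical (orth_part e f W) = (if radical W \<noteq> W then radical W else orth_part e f W)"
        using obtain_adapted_pair[OF U False W] by blast
      \<comment> \<open>Being totally isotropic and being zero are both visible in the two
        cardinalities that agree.\<close>
      have shape: "shape W' = shape W" and rad: "radical W = W \<longleftrightarrow> radical W' = W'"
        using radical_eq_iff_card[OF W(1)] radical_eq_iff_card[OF W'(1)]
          lin_subspace_card_eq_1[OF W(1)] lin_subspace_card_eq_1[OF W'(1)] less.prems(10,11)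
        by (auto simp: shape_def)
      let ?U = "orth_part e f U" and ?U' = "orth_part e' f' U'" and ?W = "orth_part e f W" and ?W' = "orth_part e' f' W'"
      have WV: "W \<subseteq> carrier_vec n" "W' \<subseteq> carrier_vec n" "U \<subseteq> carrier_vec n" "U' \<subseteq> carrier_vec n"
        using lin_subspaceD(1) W W' U U' by blast+
      \<comment> \<open>Even for zero \<open>W\<close> the shape contains \<open>(0, 0)\<close>, so
        its size is a factor that can be cancelled.\<close>
      have shape_pos: "card (shape W) > 0"
        by (simp add: card_gt_0_iff shape_def)
      have sW: "lin_subspace n ?W" "lin_subspace n ?W'" "lin_subspace n ?U" "lin_subspace n ?U'"
        using lin_subspace_orth_part[OF p(1)] lin_subspace_orth_part[OF p'(1)] W W' U U' by auto
      have cW: "card ?W = card ?W'"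
        using card_splits[OF p(1) WV(1) p(4)] card_splits[OF p'(1) WV(2) p'(4)] less.prems(10) shape shape_pos
        by (metis mult_left_cancel less_not_refl)
      have cU: "card U = card (UNIV :: ('a \<times> 'a) set) * card ?U" "card U' = card (UNIV :: ('a \<times> 'a) set) * card ?U'"
        using card_splits[OF p(1) WV(3) splits_full[OF p(1) U(1) p(2,3)]]
          card_splits[OF p'(1) WV(4) splits_full[OF p'(1) U'(1) p'(2,3)]] by auto
      \<comment> \<open>The pairing of \<open>f\<close> with \<open>e\<close> is \<open>- 1\<close>,
        so passing to the complement really shrinks \<open>U\<close>.\<close>
      have "f \<notin> ?U" using hyperbolic_pairD(4)[OF p(1)] by (simp add: orth_part_def)
      then have "?U \<subset> U" using p(3) by (auto simp: orth_part_def)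
      then have lt: "card ?U < card U" by (rule psubset_card_mono[OF finite_lin_subspace[OF U(1)]])
      have "\<exists>g. isometry_on g ?U ?U' \<and> g ` ?W = ?W'"
      proof (rule less.hyps[OF lt sW(3) _ sW(4) _ _ sW(1) _ sW(2) _ cW])
        show "nondegenerate ?U" by (rule nondegenerate_orth_part[OF p(1) U(1) p(2,3) U(2)])
        show "nondegenerate ?U'" by (rule nondegenerate_orth_part[OF p'(1) U'(1) p'(2,3) U'(2)])
        show "card ?U = card ?U'" using cU less.prems(5) by simp
        show "?W \<subseteq> ?U" "?W' \<subseteq> ?U'" using W(2) W'(2) by (auto simp: orth_part_def)
        \<comment> \<open>Either both radicals are inherited unchanged, or each is the whole
          remaining subspace and \<open>cW\<close> applies.\<close>
        show "card (radical ?W) = card (radical ?W')" using p(5) p'(5) rad cW less.prems(11) by auto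
      qed
      then obtain g where g: "isometry_on g ?U ?U'" "g ` ?W = ?W'" by blast
      show ?thesis
        using isometry_extend[OF p(1) p'(1) U(1) p(2,3) U'(1) p'(2,3) g(1)]
          isometry_extend_image[OF p(1) p'(1) WV(1) p(4) WV(2) p'(4)[unfolded shape] g(2)] by blast
    qed
  qed
  then show ?thesis using that by blast
qed

text \<open>The space consists of \<open>k\<close> orthogonal hyperbolic planes. A subspace of the
  desired kind takes \<open>s\<close> of them entirely and a line from each of
  \<open>m - 2 * s\<close> others, which uses \<open>m - s\<close> planes; this is the bound
  \<open>m \<le> k + s\<close>. The induction handles one plane at a time, whole planes
  first.\<close>

lemma exists_subspace_of_cards:
  assumes "lin_subspace n U" "nondegenerate U" "card U = CARD('a) ^ (2 * k)" "2 * s \<le> m" "m \<le> k + s"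
  obtains W where "lin_subspace n W" "W \<subseteq> U" "card W = CARD('a) ^ m" "card (radical W) = CARD('a) ^ (m - 2 * s)"
proof -
  have "\<exists>W. lin_subspace n W \<and> W \<subseteq> U \<and> card W = CARD('a) ^ m \<and> card (radical W) = CARD('a) ^ (m - 2 * s)"
    using assms
  proof (induction k arbitrary: U m s)
    case 0
    \<comment> \<open>Without any plane the inequalities read \<open>2 * s \<le> m\<close> and
      \<open>m \<le> s\<close>.\<close>
    then have "m = 0" "s = 0" by auto
    moreover have "radical {0\<^sub>v n} = {0\<^sub>v n}" by (auto simp: radical_def zero_left)
    ultimately show ?case
      using lin_subspace_zero lin_subspaceD(2)[OF 0(1)] by (intro exI[of _ "{0\<^sub>v n}"]) auto
  next
    case (Suc k)
    note U = Suc.prems(1,2)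
    have q1: "CARD('a) > 1" by (rule card_field_gt_1)
    have "card U \<noteq> 1" using Suc.prems(3) q1 by simp
    then have "U \<noteq> {0\<^sub>v n}" using lin_subspace_card_eq_1[OF U(1)] by simp
    then obtain e f where p: "hyperbolic_pair e f" "e \<in> U" "f \<in> U"
      using obtain_adapted_pair[OF U _ lin_subspace_zero] lin_subspaceD(2)[OF U(1)] by (metis empty_subsetI insert_subset)
    note pD = hyperbolic_pairD[OF p(1)]
    let ?U = "orth_part e f U"
    have sU: "lin_subspace n ?U" by (rule lin_subspace_orth_part[OF p(1) U(1)])
    have ndU: "nondegenerate ?U" by (rule nondegenerate_orth_part[OF p(1) U(1) p(2,3) U(2)])
    have "card U = card (UNIV :: ('a \<times> 'a) set) * card ?U"
      by (rule card_splits[OF p(1) lin_subspaceD(1)[OF U(1)] splits_full[OF p(1) U(1) p(2,3)]])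
    then have cU: "card ?U = CARD('a) ^ (2 * k)" using Suc.prems(3) q1 by (simp add: card_prod)
    have UU: "?U \<subseteq> U" by (auto simp: orth_part_def)
    have Uo: "?U \<subseteq> orth_part e f (carrier_vec n)" by (rule orth_part_mono[OF p(1) lin_subspaceD(1)[OF U(1)]])
    consider "s > 0" | "s = 0" "m > 0" | "s = 0" "m = 0" by blast
    then show ?case
    proof cases
      case 1
      have "2 * (s - 1) \<le> m - 2" "m - 2 \<le> k + (s - 1)" using 1 Suc.prems(4,5) by linarith+
      then obtain W where W: "lin_subspace n W" "W \<subseteq> ?U" "card W = CARD('a) ^ (m - 2)"
        "card (radical W) = CARD('a) ^ (m - 2 - 2 * (s - 1))"
        using Suc.IH[OF sU ndU cU] by blast
      let ?W = "line_ext (line_ext W e) f"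
      have s1: "lin_subspace n (line_ext W e)" by (rule lin_subspace_line_ext[OF W(1) pD(1)])
      have s2: "lin_subspace n ?W" by (rule lin_subspace_line_ext[OF s1 pD(2)])
      have e: "e \<in> ?W" and f: "f \<in> ?W" and WW: "W \<subseteq> ?W"
        using subset_line_ext[OF W(1) pD(1)] subset_line_ext[OF s1 pD(2)] by auto
      have sub: "?W \<subseteq> U"
        by (intro line_ext_subset[OF U(1)] p) (use W(2) UU in blast)
      \<comment> \<open>Once the complement of the plane in \<open>?W\<close> is known to be
        \<open>W\<close>, the size and the radical of \<open>?W\<close> follow from the splitting
        lemmas.\<close>
      have "orth_part e f ?W = W"
      proof
        show "W \<subseteq> orth_part e f ?W" using WW W(2) by (auto simp: orth_part_def)
        show "orth_part e f ?W \<subseteq> W"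
        proof
          fix x assume x: "x \<in> orth_part e f ?W"
          then obtain w \<alpha> \<beta> where w: "w \<in> W" "x = w + \<alpha> \<cdot>\<^sub>v e + \<beta> \<cdot>\<^sub>v f"
            by (auto simp: orth_part_def line_ext_def)
          have wo: "w \<in> orth_part e f (carrier_vec n)" using w W(2) Uo by blast
          have xc: "x = comb e f \<alpha> \<beta> w"
            using w orth_partD(1)[OF p(1) wo] pD by (intro eq_vecI) (auto simp: comb_def algebra_simps)
          have "\<alpha> = 0" "\<beta> = 0"
            using x comb_coords(1,3)[OF p(1) wo, of \<alpha> \<beta>] unfolding xc by (auto simp: orth_part_def)
          then have "x = w" using w orth_partD(1)[OF p(1) wo] pD by (intro eq_vecI) auto
          then show "x \<in> W" using w by simp
        qed
      qed
      then have "card ?W = card (UNIV :: ('a \<times> 'a) set) * card W" "radical ?W = radical W"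
        using card_splits[OF p(1) lin_subspaceD(1)[OF s2] splits_full[OF p(1) s2 e f]]
          radical_orth_part_full[OF p(1) s2 e f] by auto
      moreover have "CARD('a) * CARD('a) * CARD('a) ^ (m - 2) = CARD('a) ^ m"
      proof -
        have "m = Suc (Suc (m - 2))" using 1 Suc.prems(4) by linarith
        then show ?thesis by (metis mult.assoc power_Suc)
      qed
      moreover have "m - 2 - 2 * (s - 1) = m - 2 * s" using 1 by linarith
      ultimately show ?thesis using s2 sub W(3,4) by (intro exI[of _ ?W]) (simp add: card_prod)
    next
      case 2
      obtain W where W: "lin_subspace n W" "W \<subseteq> ?U" "card W = CARD('a) ^ (m - 1)"
        "card (radical W) = CARD('a) ^ (m - 1)"
        using Suc.IH[OF sU ndU cU, of 0 "m - 1"] 2 Suc.prems(5) by (auto simp: le_diff_conv)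
      have ti: "radical W = W" using radical_eq_iff_card[OF W(1)] W(3,4) by simp
      let ?W = "line_ext W e"
      \<comment> \<open>All of \<open>W\<close> is orthogonal to \<open>f\<close>, whereas
        \<open>b e f\<close> is 1.\<close>
      have "e \<notin> W" using W(2) pD by (auto simp: orth_part_def)
      then have "card ?W = CARD('a) ^ m" using card_line_ext[OF W(1) pD(1)] W(3) 2 by (simp add: power_eq_if)
      moreover have "radical ?W = ?W"
      proof -
        have "b x y = 0" if x: "x \<in> ?W" and y: "y \<in> ?W" for x y
        proof -
          obtain u \<alpha> v \<beta> where u: "x = u + \<alpha> \<cdot>\<^sub>v e" "u \<in> W" and v: "y = v + \<beta> \<cdot>\<^sub>v e" "v \<in> W"
            using x y by (auto simp: line_ext_def)
          have o: "u \<in> orth_part e f (carrier_vec n)" "v \<in> orth_part e f (carrier_vec n)"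
            using u v W(2) Uo by auto
          have "b u v = 0" using ti u(2) v(2) by (auto simp: radical_def)
          then show ?thesis
            using u v pD orth_partD[OF p(1) o(1)] orth_partD[OF p(1) o(2)] by (simp add: bilinear)
        qed
        then show ?thesis by (auto simp: radical_def)
      qed
      moreover have "?W \<subseteq> U" by (intro line_ext_subset[OF U(1)] p) (use W(2) UU in blast)
      ultimately show ?thesis
        using 2 lin_subspace_line_ext[OF W(1) pD(1)] by (intro exI[of _ ?W]) simp
    next
      case 3
      have "radical {0\<^sub>v n} = {0\<^sub>v n}" by (auto simp: radical_def zero_left)
      then show ?thesis
        using 3 lin_subspace_zero lin_subspaceD(2)[OF U(1)] by (intro exI[of _ "{0\<^sub>v n}"]) auto
    qed
  qed
  then show ?thesis using that by blast
qed

end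

subsection \<open>The symplectic form and the type of a subspace\<close>

text \<open>Rank and nullity in counting form: every nonempty fibre is a translate of the
  kernel.\<close>

lemma card_kernel_range:
  fixes A :: "'a::{field,finite} mat"
  assumes A: "A \<in> carrier_mat n k"
  shows "card ((\<lambda>x. A *\<^sub>v x) ` carrier_vec k) * card {x \<in> carrier_vec k. A *\<^sub>v x = 0\<^sub>v n} = CARD('a) ^ k"
proof -
  let ?K = "{x \<in> carrier_vec k. A *\<^sub>v x = 0\<^sub>v n}"
  have fib: "card {x \<in> carrier_vec k. A *\<^sub>v x = y} = card ?K"
    if "y \<in> (\<lambda>x. A *\<^sub>v x) ` carrier_vec k" for y
  proof -
    obtain z where z: "z \<in> carrier_vec k" "y = A *\<^sub>v z" using \<open>y \<in> _\<close> by blast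
    have "bij_betw (\<lambda>x. x + z) ?K {x \<in> carrier_vec k. A *\<^sub>v x = y}"
    proof (rule bij_betwI[where g = "\<lambda>x. x - z"])
      show "(\<lambda>x. x + z) \<in> ?K \<rightarrow> {x \<in> carrier_vec k. A *\<^sub>v x = y}"
        using z A by (auto simp: mult_add_distrib_mat_vec[OF A])
      show "(\<lambda>x. x - z) \<in> {x \<in> carrier_vec k. A *\<^sub>v x = y} \<rightarrow> ?K"
        using z A by (auto simp: mult_minus_distrib_mat_vec[OF A])
    qed (use z in \<open>auto intro!: eq_vecI\<close>)
    from bij_betw_same_card[OF this] show ?thesis by simp
  qed
  have "CARD('a) ^ k = (\<Sum>x\<in>(carrier_vec k :: 'a vec set). 1)" by (simp add: card_carrier_vec)
  also have "\<dots> = (\<Sum>y\<in>(\<lambda>x. A *\<^sub>v x) ` carrier_vec k. \<Sum>x\<in>{x \<in> carrier_vec k. A *\<^sub>v x = y}. 1)"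
    by (rule sum.image_gen[OF finite_carrier_vec])
  also have "\<dots> = (\<Sum>y\<in>(\<lambda>x. A *\<^sub>v x) ` carrier_vec k. card ?K)"
    by (rule sum.cong) (auto simp: fib)
  finally show ?thesis by simp
qed

definition symp_form :: "nat \<Rightarrow> 'a::field vec \<Rightarrow> 'a vec \<Rightarrow> 'a" where
  "symp_form \<nu> x y = x \<bullet> (symp_mat \<nu> *\<^sub>v y)"

lemma symp_mat_carrier: "symp_mat \<nu> \<in> carrier_mat (2 * \<nu>) (2 * \<nu>)"
  by (simp add: symp_mat_def mult_2)

lemma symp_mat_dim [simp]: "dim_row (symp_mat \<nu>) = 2 * \<nu>" "dim_col (symp_mat \<nu>) = 2 * \<nu>"
  using symp_mat_carrier[of \<nu>] by auto

lemma symp_mat_mult_vec: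
  fixes y :: "'a::field vec"
  assumes y: "y \<in> carrier_vec (2 * \<nu>)" and i: "i < \<nu>"
  shows "(symp_mat \<nu> *\<^sub>v y) $ i = y $ (i + \<nu>)" "(symp_mat \<nu> *\<^sub>v y) $ (i + \<nu>) = - y $ i"
proof -
  have "row (symp_mat \<nu> :: 'a mat) i = unit_vec (2 * \<nu>) (i + \<nu>)"
    using i by (intro eq_vecI) (auto simp: symp_mat_def unit_vec_def)
  then show "(symp_mat \<nu> *\<^sub>v y) $ i = y $ (i + \<nu>)"
    using i y by (simp add: scalar_prod_left_unit)
  have "row (symp_mat \<nu> :: 'a mat) (i + \<nu>) = - unit_vec (2 * \<nu>) i"
    using i by (intro eq_vecI) (auto simp: symp_mat_def unit_vec_def)
  then show "(symp_mat \<nu> *\<^sub>v y) $ (i + \<nu>) = - y $ i"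
    using i y by (simp add: scalar_prod_left_unit)
qed

text \<open>The index range is cut at \<nu>, and coordinates \<open>i\<close> and
  \<open>i + \<nu>\<close> are paired. In this form bilinearity and the alternating law can be
  checked term by term.\<close>

lemma symp_form_sum:
  assumes x: "x \<in> carrier_vec (2 * \<nu>)" and y: "y \<in> carrier_vec (2 * \<nu>)"
  shows "symp_form \<nu> x y = (\<Sum>i<\<nu>. x $ i * y $ (i + \<nu>) - x $ (i + \<nu>) * y $ i)"
proof -
  let ?t = "\<lambda>i. x $ i * (symp_mat \<nu> *\<^sub>v y) $ i"
  have "symp_form \<nu> x y = sum ?t {0..<\<nu> + \<nu>}"
    unfolding symp_form_def scalar_prod_def[of x] by (simp add: mult_2 del: index_mult_mat_vec)
  also have "\<dots> = sum ?t {0..<\<nu>} + sum ?t {0 + \<nu>..<\<nu> + \<nu>}"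
    by (simp add: sum.atLeastLessThan_concat)
  also have "\<dots> = (\<Sum>i<\<nu>. ?t i + ?t (i + \<nu>))"
    by (simp only: sum.shift_bounds_nat_ivl sum.distrib lessThan_atLeast0)
  also have "\<dots> = (\<Sum>i<\<nu>. x $ i * y $ (i + \<nu>) - x $ (i + \<nu>) * y $ i)"
    by (rule sum.cong) (auto simp: symp_mat_mult_vec[OF y] simp del: index_mult_mat_vec)
  finally show ?thesis .
qed

interpretation symp: alternating_form "2 * \<nu>" "symp_form \<nu> :: 'a::{field,finite} vec \<Rightarrow> _" for \<nu>
  by unfold_locales
    (auto simp: symp_form_sum sum.distrib[symmetric] sum_distrib_left algebra_simps intro!: sum.cong)

text \<open>Pairing with unit vectors isolates the coordinates: position \<open>i + \<nu>\<close>
  tests coordinate \<open>i\<close>, and position \<open>i\<close> tests coordinate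
  \<open>i + \<nu>\<close> up to sign.\<close>

lemma symp_nondegenerate:
  "symp.nondegenerate \<nu> (carrier_vec (2 * \<nu>) :: 'a::{field,finite} vec set)"
  unfolding symp.nondegenerate_def
proof (intro ballI impI)
  fix x :: "'a vec" assume x: "x \<in> carrier_vec (2 * \<nu>)" and h: "\<forall>y\<in>carrier_vec (2 * \<nu>). symp_form \<nu> x y = 0"
  have "x $ i = 0 \<and> x $ (i + \<nu>) = 0" if i: "i < \<nu>" for i
  proof -
    have "0 = symp_form \<nu> x (unit_vec (2 * \<nu>) (i + \<nu>))" using h by simp
    also have "\<dots> = (\<Sum>j<\<nu>. if j = i then x $ i else 0)"
      unfolding symp_form_sum[OF x unit_vec_carrier] by (rule sum.cong) (use i in \<open>auto simp: unit_vec_def\<close>)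
    finally have 1: "x $ i = 0" using i by simp
    have "0 = symp_form \<nu> x (unit_vec (2 * \<nu>) i)" using h by simp
    also have "\<dots> = (\<Sum>j<\<nu>. if j = i then - x $ (i + \<nu>) else 0)"
      unfolding symp_form_sum[OF x unit_vec_carrier] by (rule sum.cong) (use i in \<open>auto simp: unit_vec_def\<close>)
    finally show ?thesis using 1 i by simp
  qed
  then have "x $ i = 0" if "i < 2 * \<nu>" for i
    using that by (cases "i < \<nu>") (auto, metis add_diff_inverse_nat add.commute less_diff_conv2 mult_2 not_less)
  then show "x = 0\<^sub>v (2 * \<nu>)" using x by (intro eq_vecI) auto
qed

text \<open>The product \<open>P * symp_mat \<nu> * Q\<^sup>T\<close> is the Gram matrix of the form
  with respect to the rows of \<open>P\<close> and \<open>Q\<close>. This links the matrix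
  definitions to the form.\<close>

lemma symp_form_gram:
  fixes P Q :: "'a::field mat"
  assumes P: "P \<in> carrier_mat k (2 * \<nu>)" and Q: "Q \<in> carrier_mat l (2 * \<nu>)"
    and c: "c \<in> carrier_vec k" and d: "d \<in> carrier_vec l"
  shows "symp_form \<nu> (P\<^sup>T *\<^sub>v c) (Q\<^sup>T *\<^sub>v d) = c \<bullet> ((P * symp_mat \<nu> * Q\<^sup>T) *\<^sub>v d)"
proof -
  note K = symp_mat_carrier[of \<nu>, where 'a='a]
  have Qd: "Q\<^sup>T *\<^sub>v d \<in> carrier_vec (2 * \<nu>)" using Q d by simp
  have "symp_form \<nu> (P\<^sup>T *\<^sub>v c) (Q\<^sup>T *\<^sub>v d) = c \<bullet> (P *\<^sub>v (symp_mat \<nu> *\<^sub>v (Q\<^sup>T *\<^sub>v d)))"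
    unfolding symp_form_def by (rule transpose_vec_mult_scalar[OF P _ c]) (use K Qd in simp)
  also have "P *\<^sub>v (symp_mat \<nu> *\<^sub>v (Q\<^sup>T *\<^sub>v d)) = (P * symp_mat \<nu>) *\<^sub>v (Q\<^sup>T *\<^sub>v d)"
    by (rule assoc_mult_mat_vec[OF P K Qd, symmetric])
  also have "\<dots> = (P * symp_mat \<nu> * Q\<^sup>T) *\<^sub>v d"
    by (rule assoc_mult_mat_vec[symmetric]) (use P K Q d in auto)
  finally show ?thesis .
qed

lemma representsD_carrier: "represents n P W \<Longrightarrow> P \<in> carrier_mat (dim_row P) n"
  by (auto simp: represents_def)

text \<open>A zero Gram matrix kills all combinations of rows, and conversely its entries are values
  of the form. The choice of basis matrices thereby disappears from adjacency.\<close>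

lemma spi_adj_iff:
  fixes A B :: "'a::field vec set"
  assumes A: "lin_subspace (2 * \<nu>) A" and B: "lin_subspace (2 * \<nu>) B"
  shows "spi_adj \<nu> A B \<longleftrightarrow> (\<forall>x\<in>A. \<forall>y\<in>B. symp_form \<nu> x y = 0)"
proof
  assume "spi_adj \<nu> A B"
  then obtain P Q where P: "represents (2 * \<nu>) P A" and Q: "represents (2 * \<nu>) Q B"
    and z: "P * symp_mat \<nu> * Q\<^sup>T = 0\<^sub>m (dim_row P) (dim_row Q)" by (auto simp: spi_adj_def)
  show "\<forall>x\<in>A. \<forall>y\<in>B. symp_form \<nu> x y = 0"
  proof (intro ballI)
    fix x y assume "x \<in> A" "y \<in> B"
    then obtain c d where c: "c \<in> carrier_vec (dim_row P)" "x = P\<^sup>T *\<^sub>v c"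
      and d: "d \<in> carrier_vec (dim_row Q)" "y = Q\<^sup>T *\<^sub>v d"
      using represents_imp_range(1)[OF P] represents_imp_range(1)[OF Q] by blast
    have "0\<^sub>m (dim_row P) (dim_row Q) *\<^sub>v d = 0\<^sub>v (dim_row P)"
      using d(1) by (intro eq_vecI) auto
    then show "symp_form \<nu> x y = 0"
      using symp_form_gram[OF representsD_carrier[OF P] representsD_carrier[OF Q] c(1) d(1)] c d
      unfolding z by simp
  qed
next
  assume h: "\<forall>x\<in>A. \<forall>y\<in>B. symp_form \<nu> x y = 0"
  obtain P where P: "represents (2 * \<nu>) P A" using subspace_represented_dim[OF A] by blast
  obtain Q where Q: "represents (2 * \<nu>) Q B" using subspace_represented_dim[OF B] by blast
  let ?M = "P * symp_mat \<nu> * Q\<^sup>T"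
  have M: "?M \<in> carrier_mat (dim_row P) (dim_row Q)" by (intro carrier_matI) auto
  have "?M = 0\<^sub>m (dim_row P) (dim_row Q)"
  proof (rule eq_matI)
    fix i j assume "i < dim_row (0\<^sub>m (dim_row P) (dim_row Q))" "j < dim_col (0\<^sub>m (dim_row P) (dim_row Q))"
    then have i: "i < dim_row P" and j: "j < dim_row Q" by simp_all
    let ?u = "unit_vec (dim_row P) i :: 'a vec" and ?v = "unit_vec (dim_row Q) j :: 'a vec"
    \<comment> \<open>An entry of the Gram matrix is obtained by evaluating the form at unit
      coordinate vectors, that is, at one row of \<open>P\<close> and one row of
      \<open>Q\<close>.\<close>
    have "?M $$ (i, j) = row ?M i \<bullet> ?v" using i j M by (simp add: scalar_prod_right_unit del: index_mult_mat)
    also have "\<dots> = ?u \<bullet> (?M *\<^sub>v ?v)" using i M by (simp add: scalar_prod_left_unit)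
    also have "\<dots> = symp_form \<nu> (P\<^sup>T *\<^sub>v ?u) (Q\<^sup>T *\<^sub>v ?v)"
      by (rule symp_form_gram[OF representsD_carrier[OF P] representsD_carrier[OF Q], symmetric]) auto
    also have "\<dots> = 0"
      using h by (simp add: represents_imp_range(1)[OF P] represents_imp_range(1)[OF Q])
    finally show "?M $$ (i, j) = 0\<^sub>m (dim_row P) (dim_row Q) $$ (i, j)" using i j by simp
  qed (use M in auto)
  then show "spi_adj \<nu> A B" using P Q by (auto simp: spi_adj_def)
qed

text \<open>In the coordinates given by \<open>P\<close> the radical is the kernel of the Gram
  matrix, so counting kernel and image gives the relation.\<close>

lemma card_radical_rank:
  fixes P :: "'a::{field,finite} mat"
  assumes P: "P \<in> carrier_mat m (2 * \<nu>)" and rep: "represents (2 * \<nu>) P W"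
  shows "CARD('a) ^ vec_space.rank m (P * symp_mat \<nu> * P\<^sup>T) * card (symp.radical \<nu> W) = CARD('a) ^ m"
proof -
  let ?M = "P * symp_mat \<nu> * P\<^sup>T"
  have M: "?M \<in> carrier_mat m m" using P by (intro carrier_matI) auto
  have dm: "dim_row P = m" using P by simp
  have W: "W = (\<lambda>c. P\<^sup>T *\<^sub>v c) ` carrier_vec m" and inj: "inj_on (\<lambda>c. P\<^sup>T *\<^sub>v c) (carrier_vec m)"
    using represents_imp_range[OF rep] unfolding dm by auto
  have cV: "P\<^sup>T *\<^sub>v c \<in> carrier_vec (2 * \<nu>)" if "c \<in> carrier_vec m" for c using P that by simp
  have iff: "P\<^sup>T *\<^sub>v c \<in> symp.radical \<nu> W \<longleftrightarrow> ?M *\<^sub>v c = 0\<^sub>v m" if c: "c \<in> carrier_vec m" for c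
  proof -
    have "P\<^sup>T *\<^sub>v c \<in> symp.radical \<nu> W \<longleftrightarrow> (\<forall>d\<in>carrier_vec m. symp_form \<nu> (P\<^sup>T *\<^sub>v c) (P\<^sup>T *\<^sub>v d) = 0)"
      using c by (auto simp: symp.radical_def W)
    \<comment> \<open>The arguments are exchanged so that the Gram matrix acts on \<open>c\<close>
      from the left.\<close>
    also have "\<dots> \<longleftrightarrow> (\<forall>d\<in>carrier_vec m. symp_form \<nu> (P\<^sup>T *\<^sub>v d) (P\<^sup>T *\<^sub>v c) = 0)"
      using symp.orth_sym[OF cV[OF c] cV] by blast
    also have "\<dots> \<longleftrightarrow> (\<forall>d\<in>carrier_vec m. d \<bullet> (?M *\<^sub>v c) = 0)"
      using symp_form_gram[OF P P _ c] by simp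
    also have "\<dots> \<longleftrightarrow> ?M *\<^sub>v c = 0\<^sub>v m"
    proof
      assume h: "\<forall>d\<in>carrier_vec m. d \<bullet> (?M *\<^sub>v c) = 0"
      have Mc: "?M *\<^sub>v c \<in> carrier_vec m" using M c by simp
      have "(?M *\<^sub>v c) $ i = 0" if "i < m" for i
        using h[rule_format, OF unit_vec_carrier[of m i]] scalar_prod_left_unit[OF Mc that] by simp
      then show "?M *\<^sub>v c = 0\<^sub>v m" using Mc P by (intro eq_vecI) auto
    qed auto
    finally show ?thesis .
  qed
  have "symp.radical \<nu> W = (\<lambda>c. P\<^sup>T *\<^sub>v c) ` {c \<in> carrier_vec m. ?M *\<^sub>v c = 0\<^sub>v m}"
  proof -
    have "symp.radical \<nu> W \<subseteq> W" by (auto simp: symp.radical_def)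
    then show ?thesis using iff unfolding W by auto
  qed
  then have "card (symp.radical \<nu> W) = card {c \<in> carrier_vec m. ?M *\<^sub>v c = 0\<^sub>v m}"
    using card_image[OF inj_on_subset[OF inj]] by simp
  then show ?thesis using card_kernel_range[OF M] card_range_rank[OF M] by simp
qed

text \<open>The radical has dimension \<open>m\<close> minus the rank of the Gram matrix. Powers of
  the field order, which exceeds 1, determine their exponents, so the two cardinalities carry the
  same information as dimension and rank.\<close>

lemma subspaces_of_type_iff:
  fixes W :: "'a::{field,finite} vec set"
  assumes "2 * s \<le> m"
  shows "W \<in> subspaces_of_type m s \<nu> \<longleftrightarrow>
    lin_subspace (2 * \<nu>) W \<and> card W = CARD('a) ^ m \<and> card (symp.radical \<nu> W) = CARD('a) ^ (m - 2 * s)"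
    (is "?L \<longleftrightarrow> ?R")
proof -
  note q = card_field_gt_1[where 'a='a]
  have split: "CARD('a) ^ m = CARD('a) ^ (2 * s) * CARD('a) ^ (m - 2 * s)"
    using assms by (simp flip: power_add)
  show ?thesis
  proof
    assume ?L
    then obtain P where W: "lin_subspace (2 * \<nu>) W" and P: "P \<in> carrier_mat m (2 * \<nu>)" "represents (2 * \<nu>) P W"
      and r: "vec_space.rank m (P * symp_mat \<nu> * P\<^sup>T) = 2 * s" by (auto simp: subspaces_of_type_def)
    show ?R using card_radical_rank[OF P] card_represents[OF P(2)] P(1) W q split unfolding r by auto
  next
    assume R: ?R
    then obtain P where P: "represents (2 * \<nu>) P W" using subspace_represented_dim by blast
    have "dim_row P = m" using card_represents[OF P] R q by simp
    then have Pm: "P \<in> carrier_mat m (2 * \<nu>)" using P by (auto simp: represents_def)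
    have "CARD('a) ^ vec_space.rank m (P * symp_mat \<nu> * P\<^sup>T) = CARD('a) ^ (2 * s)"
      using card_radical_rank[OF Pm P] R q split by auto
    then have "vec_space.rank m (P * symp_mat \<nu> * P\<^sup>T) = 2 * s" using q by simp
    then show ?L using R P Pm by (auto simp: subspaces_of_type_def)
  qed
qed

subsection \<open>Automorphisms of the graph\<close>

lemma spi_verts_iff:
  "W \<in> spi_verts \<nu> \<longleftrightarrow> lin_subspace (2 * \<nu>) W \<and> W \<noteq> {0\<^sub>v (2 * \<nu>)} \<and> W \<noteq> carrier_vec (2 * \<nu>)"
  by (simp add: spi_verts_def)

lemma spi_adj_perp_iff:
  fixes A B :: "'a::{field,finite} vec set"
  assumes "A \<in> spi_verts \<nu>" "B \<in> spi_verts \<nu>"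
  shows "spi_adj \<nu> A B \<longleftrightarrow> B \<subseteq> symp.perp \<nu> A"
proof -
  have s: "lin_subspace (2 * \<nu>) A" "lin_subspace (2 * \<nu>) B" using assms by (simp_all add: spi_verts_iff)
  show ?thesis
    unfolding spi_adj_iff[OF s] symp.perp_def using lin_subspaceD(1)[OF s(2)] by blast
qed

text \<open>Nondegeneracy gives both halves: a vector outside \<open>A\<close> is separated by a
  nonzero element of the perp, and a nonzero vector of \<open>A\<close> has a vector not orthogonal
  to it. Being a vertex, the perp can be written as the image of a vertex under an
  automorphism.\<close>

lemma perp_in_spi_verts:
  fixes A :: "'a::{field,finite} vec set"
  assumes A: "A \<in> spi_verts \<nu>"
  shows "symp.perp \<nu> A \<in> spi_verts \<nu>"
proof -
  have sA: "lin_subspace (2 * \<nu>) A" using A by (simp add: spi_verts_iff)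
  note D = lin_subspaceD[OF sA]
  obtain a where a: "a \<in> carrier_vec (2 * \<nu>)" "a \<notin> A" using A D(1) by (auto simp: spi_verts_iff)
  obtain x where x: "x \<in> symp.perp \<nu> A" "symp_form \<nu> a x \<noteq> 0"
    using symp.separating_vector[OF symp_nondegenerate sA a] .
  have "x \<noteq> 0\<^sub>v (2 * \<nu>)" using x a symp.zero_right by metis
  then have 1: "symp.perp \<nu> A \<noteq> {0\<^sub>v (2 * \<nu>)}" using x by blast
  obtain y where y: "y \<in> A" "y \<noteq> 0\<^sub>v (2 * \<nu>)" using A D(2) by (auto simp: spi_verts_iff)
  then obtain z where z: "z \<in> carrier_vec (2 * \<nu>)" "symp_form \<nu> y z \<noteq> 0"
    using symp_nondegenerate[of \<nu>] D(3) unfolding symp.nondegenerate_def by blast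
  then have "symp.perp \<nu> A \<noteq> carrier_vec (2 * \<nu>)" using y unfolding symp.perp_def by blast
  then show ?thesis using 1 symp.lin_subspace_perp[OF D(1)] by (simp add: spi_verts_iff)
qed

section \<open>Inclusion, cardinality and radical under automorphisms\<close>

lemma spi_Aut_iff:
  "f \<in> carrier (spi_Aut \<nu>) \<longleftrightarrow> f \<in> Bij (spi_verts \<nu>) \<and>
     (\<forall>x\<in>spi_verts \<nu>. \<forall>y\<in>spi_verts \<nu>. spi_adj \<nu> (f x) (f y) \<longleftrightarrow> spi_adj \<nu> x y)"
  by (simp add: spi_Aut_def graph_Aut_def)

lemma spi_Aut_maps: "f \<in> carrier (spi_Aut \<nu>) \<Longrightarrow> A \<in> spi_verts \<nu> \<Longrightarrow> f A \<in> spi_verts \<nu>"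
  by (auto simp: spi_Aut_iff dest: Bij_imp_funcset)

text \<open>Inclusion is visible in the graph: \<open>A \<subseteq> B\<close> iff every neighbour of \<open>B\<close> is a neighbour of \<open>A\<close>.\<close>

lemma spi_Aut_mono:
  fixes A B :: "'a::{field,finite} vec set"
  assumes f: "f \<in> carrier (spi_Aut \<nu>)" and A: "A \<in> spi_verts \<nu>" and B: "B \<in> spi_verts \<nu>" and "A \<subseteq> B"
  shows "f A \<subseteq> f B"
proof
  fix a assume a: "a \<in> f A"
  note fA = spi_Aut_maps[OF f A] and fB = spi_Aut_maps[OF f B]
  have sB: "lin_subspace (2 * \<nu>) (f B)" using fB by (simp add: spi_verts_iff)
  have "f A \<subseteq> carrier_vec (2 * \<nu>)" using fA lin_subspaceD(1) by (auto simp: spi_verts_iff)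
  then have aV: "a \<in> carrier_vec (2 * \<nu>)" using a by blast
  \<comment> \<open>The perp of \<open>f B\<close> is the largest neighbour of \<open>f B\<close>
    and has the form \<open>f D\<close>. Its adjacency is pulled back to \<open>B\<close> and
    \<open>D\<close>, passed on to \<open>A\<close> and \<open>D\<close>, and pushed forward
    again.\<close>
  note pB = perp_in_spi_verts[OF fB]
  have "f ` spi_verts \<nu> = spi_verts \<nu>" using f by (auto simp: spi_Aut_iff Bij_def bij_betw_def)
  then have "symp.perp \<nu> (f B) \<in> f ` spi_verts \<nu>" using pB by simp
  then obtain D where D: "D \<in> spi_verts \<nu>" "f D = symp.perp \<nu> (f B)" by (metis imageE)
  have adj: "spi_adj \<nu> (f X) (f Y) \<longleftrightarrow> spi_adj \<nu> X Y" if "X \<in> spi_verts \<nu>" "Y \<in> spi_verts \<nu>" for X Y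
    using f that unfolding spi_Aut_iff by blast
  have "spi_adj \<nu> (f B) (f D)" using spi_adj_perp_iff[OF fB pB] D(2) by simp
  then have "D \<subseteq> symp.perp \<nu> B" using adj[OF B D(1)] spi_adj_perp_iff[OF B D(1)] by simp
  also have "\<dots> \<subseteq> symp.perp \<nu> A" using \<open>A \<subseteq> B\<close> by (auto simp: symp.perp_def)
  finally have "spi_adj \<nu> A D" using spi_adj_perp_iff[OF A D(1)] by simp
  then have "spi_adj \<nu> (f A) (f D)" using adj[OF A D(1)] by simp
  then have sub: "symp.perp \<nu> (f B) \<subseteq> symp.perp \<nu> (f A)"
    using spi_adj_perp_iff[OF fA pB] D(2) by simp
  \<comment> \<open>Inclusion of perps reverses: outside \<open>f B\<close>, the vector
    \<open>a\<close> would fail to be orthogonal to some element of the perp of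
    \<open>f B\<close>.\<close>
  show "a \<in> f B"
  proof (rule ccontr)
    assume "a \<notin> f B"
    then obtain x where x: "x \<in> symp.perp \<nu> (f B)" "symp_form \<nu> a x \<noteq> 0"
      using symp.separating_vector[OF symp_nondegenerate sB aV] by blast
    then show False using sub a by (auto simp: symp.perp_def)
  qed
qed

text \<open>Along a hyperplane \<open>B\<close> of \<open>A\<close> the size grows exactly by the
  field order, while the strict inclusion of \<open>f B\<close> in \<open>f A\<close> makes it grow
  at least that much on the image side.\<close>

lemma spi_Aut_card_le:
  fixes A :: "'a::{field,finite} vec set"
  assumes f: "f \<in> carrier (spi_Aut \<nu>)" and "A \<in> spi_verts \<nu>"
  shows "card A \<le> card (f A)"
  using assms(2)
proof (induction "card A" arbitrary: A rule: less_induct)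
  case less
  have sA: "lin_subspace (2 * \<nu>) A" "A \<noteq> {0\<^sub>v (2 * \<nu>)}" using less.prems by (simp_all add: spi_verts_iff)
  have sfA: "lin_subspace (2 * \<nu>) (f A)" "f A \<noteq> {0\<^sub>v (2 * \<nu>)}"
    using spi_Aut_maps[OF f less.prems] by (simp_all add: spi_verts_iff)
  obtain B where B: "lin_subspace (2 * \<nu>) B" "B \<subset> A" "card A = CARD('a) * card B"
    using obtain_hyperplane[OF sA] by metis
  show ?case
  proof (cases "B = {0\<^sub>v (2 * \<nu>)}")
    \<comment> \<open>The zero space is not a vertex, so the descent stops at lines, where
      \<open>f A\<close> being nonzero suffices.\<close>
    case True
    then show ?thesis using card_geq_field[OF sfA] B(3) by simp
  next
    case False
    then have BV: "B \<in> spi_verts \<nu>"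
      using B(1,2) lin_subspaceD(1)[OF sA(1)] by (auto simp: spi_verts_iff)
    have "card B < card A" by (rule psubset_card_mono[OF finite_lin_subspace[OF sA(1)] B(2)])
    then have le: "card B \<le> card (f B)" using less.hyps[OF _ BV] by blast
    have "inj_on f (spi_verts \<nu>)" using f by (auto simp: spi_Aut_iff Bij_def bij_betw_def)
    then have "f B \<noteq> f A" using BV less.prems B(2) by (auto dest: inj_onD)
    then have "f B \<subset> f A" using spi_Aut_mono[OF f BV less.prems] B(2) by blast
    moreover have "lin_subspace (2 * \<nu>) (f B)" using spi_Aut_maps[OF f BV] by (simp add: spi_verts_iff)
    ultimately have "CARD('a) * card (f B) \<le> card (f A)" by (intro card_proper_subspace[OF sfA(1)])
    then show ?thesis using mult_le_mono2[OF le, of "CARD('a)"] B(3) by linarith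
  qed
qed

text \<open>Applied to \<open>f A\<close>, the inverse automorphism turns the one-sided estimates
  for cardinalities into equalities.\<close>

lemma spi_Aut_inverse:
  fixes A :: "'a::{field,finite} vec set"
  assumes f: "f \<in> carrier (spi_Aut \<nu>)" and A: "A \<in> spi_verts \<nu>"
  obtains h where "h \<in> carrier (spi_Aut \<nu>)" "h (f A) = A"
proof -
  interpret group_action "spi_Aut \<nu>" "spi_verts \<nu>" "\<lambda>f. f"
    unfolding spi_Aut_def by (rule group_action_graph_Aut)
  have "group (spi_Aut \<nu> :: ('a vec set \<Rightarrow> 'a vec set) monoid)"
    using group_hom group_hom.axioms(1) by blast
  then have "inv\<^bsub>spi_Aut \<nu>\<^esub> f \<in> carrier (spi_Aut \<nu>)" using f by (rule group.inv_closed)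
  then show ?thesis using that orbit_sym_aux[OF f A refl] by blast
qed

lemma spi_Aut_card:
  fixes A :: "'a::{field,finite} vec set"
  assumes f: "f \<in> carrier (spi_Aut \<nu>)" and A: "A \<in> spi_verts \<nu>"
  shows "card (f A) = card A"
proof -
  obtain h where h: "h \<in> carrier (spi_Aut \<nu>)" "h (f A) = A" using spi_Aut_inverse[OF f A] .
  show ?thesis
    using spi_Aut_card_le[OF f A] spi_Aut_card_le[OF h(1) spi_Aut_maps[OF f A]] h(2) by simp
qed

text \<open>The radical is a subspace of \<open>A\<close> adjacent to \<open>A\<close>. Both
  properties survive under \<open>f\<close>, so the image of the radical lies in the radical of
  \<open>f A\<close>.\<close>

lemma spi_Aut_card_radical_le:
  fixes A :: "'a::{field,finite} vec set"
  assumes f: "f \<in> carrier (spi_Aut \<nu>)" and A: "A \<in> spi_verts \<nu>"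
  shows "card (symp.radical \<nu> A) \<le> card (symp.radical \<nu> (f A))"
proof -
  let ?R = "symp.radical \<nu> A"
  have sA: "lin_subspace (2 * \<nu>) A" using A by (simp add: spi_verts_iff)
  have fA: "f A \<in> spi_verts \<nu>" by (rule spi_Aut_maps[OF f A])
  have sfA: "lin_subspace (2 * \<nu>) (f A)" using fA by (simp add: spi_verts_iff)
  have sR: "lin_subspace (2 * \<nu>) ?R" by (rule symp.lin_subspace_radical[OF sA])
  have sfR: "lin_subspace (2 * \<nu>) (symp.radical \<nu> (f A))" by (rule symp.lin_subspace_radical[OF sfA])
  have RA: "?R \<subseteq> A" by (auto simp: symp.radical_def)
  show ?thesis
  proof (cases "?R = {0\<^sub>v (2 * \<nu>)}")
    \<comment> \<open>A zero radical is not a vertex, so \<open>f\<close> says nothing about it; its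
      size 1 is a trivial lower bound.\<close>
    case True
    then show ?thesis using card_lin_subspace_pos[OF sfR] by simp
  next
    case False
    then have R: "?R \<in> spi_verts \<nu>"
      using sR RA A lin_subspaceD(1)[OF sA] by (auto simp: spi_verts_iff)
    note fR = spi_Aut_maps[OF f R]
    have "spi_adj \<nu> ?R A" using spi_adj_iff[OF sR sA] by (auto simp: symp.radical_def)
    then have "spi_adj \<nu> (f ?R) (f A)" using f R A by (simp add: spi_Aut_iff)
    moreover have "f ?R \<subseteq> f A" by (rule spi_Aut_mono[OF f R A RA])
    moreover have "lin_subspace (2 * \<nu>) (f ?R)" using fR by (simp add: spi_verts_iff)
    ultimately have "f ?R \<subseteq> symp.radical \<nu> (f A)" using spi_adj_iff[OF _ sfA] by (auto simp: symp.radical_def)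
    then have "card (f ?R) \<le> card (symp.radical \<nu> (f A))" by (rule card_mono[OF finite_lin_subspace[OF sfR]])
    then show ?thesis using spi_Aut_card[OF f R] by simp
  qed
qed

lemma spi_Aut_card_radical:
  fixes A :: "'a::{field,finite} vec set"
  assumes f: "f \<in> carrier (spi_Aut \<nu>)" and A: "A \<in> spi_verts \<nu>"
  shows "card (symp.radical \<nu> (f A)) = card (symp.radical \<nu> A)"
proof -
  obtain h where h: "h \<in> carrier (spi_Aut \<nu>)" "h (f A) = A" using spi_Aut_inverse[OF f A] .
  show ?thesis
    using spi_Aut_card_radical_le[OF f A] spi_Aut_card_radical_le[OF h(1) spi_Aut_maps[OF f A]] h(2) by simp
qed

text \<open>Taking images under a linear bijection permutes the subspaces, and preserving the form
  preserves adjacency. The map is restricted to the vertex set because members of \<open>Bij\<close>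
  are extensional.\<close>

lemma isometry_induces_spi_Aut:
  fixes g :: "'a::{field,finite} vec \<Rightarrow> 'a vec"
  assumes g: "symp.isometry_on \<nu> g (carrier_vec (2 * \<nu>)) (carrier_vec (2 * \<nu>))"
  shows "(\<lambda>W\<in>spi_verts \<nu>. g ` W) \<in> carrier (spi_Aut \<nu>)"
proof -
  let ?V = "carrier_vec (2 * \<nu>) :: 'a vec set"
  note gD = symp.isometry_onD[OF g]
  have inj: "inj_on g ?V" using gD(1) by (simp add: bij_betw_def)
  have WV: "W \<subseteq> ?V" if "W \<in> spi_verts \<nu>" for W :: "'a vec set"
    using that lin_subspaceD(1) by (auto simp: spi_verts_iff)
  have maps: "g ` W \<in> spi_verts \<nu>" if W: "W \<in> spi_verts \<nu>" for W
  proof -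
    have sW: "lin_subspace (2 * \<nu>) W" using W by (simp add: spi_verts_iff)
    note D = lin_subspaceD[OF sW]
    have g0: "g (0\<^sub>v (2 * \<nu>)) = 0\<^sub>v (2 * \<nu>)"
    proof -
      have "g (0\<^sub>v (2 * \<nu>)) = g (0 \<cdot>\<^sub>v 0\<^sub>v (2 * \<nu>))" by (rule arg_cong[of _ _ g]) auto
      also have "\<dots> = 0 \<cdot>\<^sub>v g (0\<^sub>v (2 * \<nu>))" by (rule gD(4)) simp
      also have "\<dots> = 0\<^sub>v (2 * \<nu>)" using gD(2)[of "0\<^sub>v (2 * \<nu>)"] by (intro eq_vecI) auto
      finally show ?thesis .
    qed
    have "lin_subspace (2 * \<nu>) (g ` W)"
    proof (rule lin_subspaceI)
      show "g ` W \<subseteq> ?V" using gD(2) D(3) by blast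
      show "0\<^sub>v (2 * \<nu>) \<in> g ` W" using g0 D(2) by force
      fix x assume "x \<in> g ` W"
      then obtain u where u: "u \<in> W" "x = g u" by blast
      show "c \<cdot>\<^sub>v x \<in> g ` W" for c
        using gD(4)[OF D(3)[OF u(1)], of c] D(6)[OF u(1), of c] u(2) by (metis imageI)
      fix y assume "y \<in> g ` W"
      then obtain v where v: "v \<in> W" "y = g v" by blast
      show "x + y \<in> g ` W"
        using gD(3)[OF D(3)[OF u(1)] D(3)[OF v(1)]] D(5)[OF u(1) v(1)] u(2) v(2) by (metis imageI)
    qed
    moreover have c: "card (g ` W) = card W" by (rule card_image[OF inj_on_subset[OF inj D(1)]])
    \<comment> \<open>Since \<open>g\<close> preserves cardinalities, the image can be neither zero
      nor the whole space.\<close>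
    moreover have "card W \<noteq> 1" using W lin_subspace_card_eq_1[OF sW] by (simp add: spi_verts_iff)
    moreover have "card W \<noteq> card ?V"
      using card_subset_eq[OF finite_carrier_vec D(1)] W by (auto simp: spi_verts_iff)
    ultimately show ?thesis unfolding spi_verts_iff by (metis is_singletonI is_singleton_altdef)
  qed
  \<comment> \<open>There are finitely many vertices, so injectivity gives surjectivity.\<close>
  have "inj_on (\<lambda>W. g ` W) (spi_verts \<nu>)"
    by (rule inj_onI) (use inj_on_image_eq_iff[OF inj] WV in blast)
  moreover have "finite (spi_verts \<nu> :: 'a vec set set)"
    by (rule finite_subset[of _ "Pow ?V"]) (use WV finite_carrier_vec in auto)
  ultimately have "bij_betw (\<lambda>W. g ` W) (spi_verts \<nu>) (spi_verts \<nu>)"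
    using endo_inj_surj[of "spi_verts \<nu>" "\<lambda>W. g ` W"] maps by (auto simp: bij_betw_def)
  then have "(\<lambda>W\<in>spi_verts \<nu>. g ` W) \<in> Bij (spi_verts \<nu>)"
    by (simp add: Bij_def cong: bij_betw_cong)
  moreover have "spi_adj \<nu> (g ` A) (g ` B) \<longleftrightarrow> spi_adj \<nu> A B" if A: "A \<in> spi_verts \<nu>" and B: "B \<in> spi_verts \<nu>" for A B
  proof -
    have s: "lin_subspace (2 * \<nu>) A" "lin_subspace (2 * \<nu>) B" "lin_subspace (2 * \<nu>) (g ` A)" "lin_subspace (2 * \<nu>) (g ` B)"
      using A B maps by (auto simp: spi_verts_iff)
    show ?thesis unfolding spi_adj_iff[OF s(1,2)] spi_adj_iff[OF s(3,4)]
      using gD(5) WV[OF A] WV[OF B] by (simp add: subset_iff)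
  qed
  ultimately show ?thesis by (simp add: spi_Aut_iff)
qed

section \<open>Subspaces of a given type form an orbit\<close>

lemma subspaces_of_type_spi_verts:
  fixes W :: "'a::{field,finite} vec set"
  assumes "2 * s \<le> m" "1 \<le> m" "m < 2 * \<nu>" and W: "W \<in> subspaces_of_type m s \<nu>"
  shows "W \<in> spi_verts \<nu>"
proof -
  note q = card_field_gt_1[where 'a='a]
  have "lin_subspace (2 * \<nu>) W" and c: "card W = CARD('a) ^ m"
    using subspaces_of_type_iff[OF assms(1)] W by auto
  \<comment> \<open>The field order exceeds 1, so the exponent \<open>m\<close>, lying strictly
    between 0 and \<open>2 * \<nu>\<close>, excludes both sizes.\<close>
  moreover have "card W \<noteq> card {0\<^sub>v (2 * \<nu>) :: 'a vec}" "card W \<noteq> card (carrier_vec (2 * \<nu>) :: 'a vec set)"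
    using q assms c by (auto simp: card_carrier_vec)
  ultimately show ?thesis by (auto simp only: spi_verts_iff)
qed

theorem theorem3p5:
  fixes q \<nu> m s :: nat
  assumes "CARD('a::{field,finite}) = q"
    and "1 \<le> \<nu>"
    and "2 * s \<le> m" and "m \<le> \<nu> + s"
    and "1 \<le> m" and "m \<le> 2 * \<nu> - 1"
  shows "(subspaces_of_type m s \<nu> :: 'a vec set set) \<in> orbits (spi_Aut \<nu>) (spi_verts \<nu>) (\<lambda>f. f)"
proof -
  let ?V = "carrier_vec (2 * \<nu>) :: 'a vec set"
  have "m < 2 * \<nu>" using assms(2,6) by linarith
  note verts = subspaces_of_type_spi_verts[OF assms(3,5) this]
  note type_iff = subspaces_of_type_iff[OF assms(3), where 'a='a]
  \<comment> \<open>The bound \<open>m \<le> \<nu> + s\<close> enters here: it provides a base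
    point, as an orbit must be nonempty.\<close>
  obtain W where W: "lin_subspace (2 * \<nu>) W" "W \<subseteq> ?V" "card W = CARD('a) ^ m"
    "card (symp.radical \<nu> W) = CARD('a) ^ (m - 2 * s)"
    using symp.exists_subspace_of_cards[OF lin_subspace_carrier symp_nondegenerate card_carrier_vec assms(3,4)] .
  have Wt: "W \<in> subspaces_of_type m s \<nu>" using W type_iff by blast
  have "orbit (spi_Aut \<nu>) (\<lambda>f. f) W = subspaces_of_type m s \<nu>"
  proof
    show "orbit (spi_Aut \<nu>) (\<lambda>f. f) W \<subseteq> subspaces_of_type m s \<nu>"
    proof
      fix X assume "X \<in> orbit (spi_Aut \<nu>) (\<lambda>f. f) W"
      then obtain f where f: "f \<in> carrier (spi_Aut \<nu>)" "X = f W" by (auto simp: orbit_def)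
      have "lin_subspace (2 * \<nu>) X" using spi_Aut_maps[OF f(1) verts[OF Wt]] f(2) by (simp add: spi_verts_iff)
      then show "X \<in> subspaces_of_type m s \<nu>"
        using W spi_Aut_card[OF f(1) verts[OF Wt]] spi_Aut_card_radical[OF f(1) verts[OF Wt]] f(2) type_iff by simp
    qed
    show "subspaces_of_type m s \<nu> \<subseteq> orbit (spi_Aut \<nu>) (\<lambda>f. f) W"
    proof
      fix X :: "'a vec set" assume "X \<in> subspaces_of_type m s \<nu>"
      then have X: "lin_subspace (2 * \<nu>) X" "card X = CARD('a) ^ m" "card (symp.radical \<nu> X) = CARD('a) ^ (m - 2 * s)"
        using type_iff by auto
      obtain g where g: "symp.isometry_on \<nu> g ?V ?V" "g ` W = X"
        using symp.witt_transitivity[OF lin_subspace_carrier symp_nondegenerate lin_subspace_carrier symp_nondegenerate refl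
            W(1,2) X(1) lin_subspaceD(1)[OF X(1)]] W X by metis
      \<comment> \<open>The induced automorphism is defined by images only on vertices;
        \<open>W\<close> is one, so the value there is \<open>X\<close>.\<close>
      have "X = (\<lambda>W\<in>spi_verts \<nu>. g ` W) W" using g(2) verts[OF Wt] by simp
      then show "X \<in> orbit (spi_Aut \<nu>) (\<lambda>f. f) W"
        using isometry_induces_spi_Aut[OF g(1)] unfolding orbit_def by blast
    qed
  qed
  then show ?thesis using verts[OF Wt] by (auto simp: orbits_def)
qed

end
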